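(* Assume that $\mu(t)$ is continuous almost everywhere, that $\mu(t)\to\infty$ as $t\to\infty$, that $M(t,t+\ell)=\ell\mu(t)+o(1)$ as $t\to\infty$, and that either $M(0,\infty)<\infty$ or $\int_0^\infty \mathrm{e}^{-M(t,t+\ell)}\mu(t)\,\mathrm{d}t=\infty$ (so that $\mathbb{P}(D<\infty)=1$). Let $c$ be arbitrary and define \[ f(t)=\int_c^t \mathrm{e}^{-\ell\mu(s)}\mu(s)\,\mathrm{d}s . \] Then $\mathbb{P}(D>t)\approx_{\log}\mathrm{e}^{-f(t)}$ as $t\to\infty$.
   Context: Let $\ell>0$ be fixed. $\mathcal N$ is an inhomogeneous Poisson point process on $(0,\infty)$ with rate function $\mu(t)$, i.e. with intensity measure $\mu(t)\,\mathrm{d}t$; write $M(a,b)=\int_a^b\mu(t)\,\mathrm{d}t$. It is assumed that $M(0,t)<\infty$ for every finite $t$ and that $\mu(t)>0$ for Lebesgue-almost all $t\ge 0$. Let $0<T_1<T_2<\cdots$ be the epochs (points) of $\mathcal N$, with $T_0=0$ by convention; if $\mathcal N$ has only finitely many points, say $n$ of them, then $T_{n+1}=\infty$. Define $D=\min\{T_n:\ n\ge 0,\ T_{n+1}-T_n\ge \ell\}$, with $D=\infty$ if there is no such $n$. The relation $f(t)\approx_{\log} g(t)$ means $\log f(t)/\log g(t)\to 1$ as $t\to\infty$. The constant $c$ is any point in the domain $[0,\infty)$ of $\mu$. *)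

theory Defs
  imports "HOL-Probability.Probability" "HOL-Library.Landau_Symbols"
begin

text \<open>
  A rate function on $[0,\infty)$ is a total function \<open>real \<Rightarrow> real\<close>; its values at negative
  arguments are never used. Integrals are taken over \<^term>\<open>lebesgue\<close> rather than \<^term>\<open>lborel\<close>,
  so that rates only need to be Lebesgue measurable.
\<close>

definition cumulative_rate :: "(real \<Rightarrow> real) \<Rightarrow> real \<Rightarrow> ereal \<Rightarrow> ennreal" where
  "cumulative_rate \<mu> a b = (\<integral>\<^sup>+t\<in>{t. a < t \<and> ereal t < b}. ennreal (\<mu> t) \<partial>lebesgue)"

definition rate_function :: "(real \<Rightarrow> real) \<Rightarrow> bool" where
  "rate_function \<mu> \<longleftrightarrow>
     set_borel_measurable lebesgue {0..} \<mu> \<and>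
     (\<forall>t\<ge>0. 0 \<le> \<mu> t) \<and>
     (\<forall>t::real. cumulative_rate \<mu> 0 t < \<infinity>) \<and>
     (AE t in lebesgue. 0 \<le> t \<longrightarrow> 0 < \<mu> t)"

definition intensity_measure :: "(real \<Rightarrow> real) \<Rightarrow> real measure" where
  "intensity_measure \<mu> = density lebesgue (\<lambda>t. ennreal (\<mu> t) * indicator {0<..} t)"

text \<open>
  The intensity measures used here have no atoms, so a Poisson process is simple and is represented
  by its random set of points \<open>N \<omega>\<close>. The intensity \<open>\<Lambda>\<close> is meant to be finite on bounded sets. The
  law of the counts is spelled out because \<^const>\<open>poisson_pmf\<close> is specified only for a
  positive mean, whereas \<open>\<Lambda> B\<close> may be \<open>0\<close>.
\<close>

definition poisson_process ::
  "'w measure \<Rightarrow> real measure \<Rightarrow> ('w \<Rightarrow> real set) \<Rightarrow> bool" where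
  "poisson_process P \<Lambda> N \<longleftrightarrow>
     prob_space P \<and>
     (\<forall>\<omega>\<in>space P. N \<omega> \<subseteq> {0<..} \<and> (\<forall>t. finite (N \<omega> \<inter> {..t}))) \<and>
     (\<forall>B\<in>sets borel. bounded B \<longrightarrow>
        (\<lambda>\<omega>. card (N \<omega> \<inter> B)) \<in> measurable P (count_space UNIV) \<and>
        (\<forall>k. measure P {\<omega>\<in>space P. card (N \<omega> \<inter> B) = k} =
               measure \<Lambda> B ^ k / fact k * exp (- measure \<Lambda> B))) \<and>
     (\<forall>(I::nat set) B. finite I \<longrightarrow> (\<forall>i\<in>I. B i \<in> sets borel \<and> bounded (B i)) \<longrightarrow>
        disjoint_family_on B I \<longrightarrow>
        prob_space.indep_vars P (\<lambda>_. count_space UNIV) (\<lambda>i \<omega>. card (N \<omega> \<inter> B i)) I)"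

text \<open>
  As \<open>Inf {} = \<infinity>\<close> in \<^typ>\<open>ereal\<close>, a set with exactly \<open>n\<close> points has \<open>epoch S k = \<infinity>\<close> for all
  \<open>k > n\<close>.
\<close>

primrec epoch :: "real set \<Rightarrow> nat \<Rightarrow> ereal" where
  "epoch S 0 = 0"
| "epoch S (Suc n) = Inf {ereal x | x. x \<in> S \<and> epoch S n < ereal x}"

text \<open>
  The infimum is a minimum whenever the set is nonempty, since \<^term>\<open>epoch S\<close> is nondecreasing; it is
  \<open>\<infinity>\<close> for the empty set. The condition \<open>epoch S n < \<infinity>\<close> keeps out the indices beyond the first
  infinite epoch.
\<close>

definition gap_start :: "real \<Rightarrow> real set \<Rightarrow> ereal" where
  "gap_start l S =
     Inf {epoch S n | n. epoch S n < \<infinity> \<and> ereal l \<le> epoch S (Suc n) - epoch S n}"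

text \<open>
  Since \<open>ln 0 = 0\<close> and \<open>x / 0 = 0\<close>, the limit below forces both functions to be eventually
  nonzero.
\<close>

definition log_asymp :: "(real \<Rightarrow> real) \<Rightarrow> (real \<Rightarrow> real) \<Rightarrow> bool" where
  "log_asymp f g \<longleftrightarrow> ((\<lambda>t. ln (f t) / ln (g t)) \<longlongrightarrow> 1) at_top"

end

theory Submission
  imports Defs
begin

text \<open>
  Write \<open>u t = P (D > t)\<close>, \<open>M(a, b)\<close> for the integral of \<open>\<mu>\<close> over \<open>(a, b)\<close>, and
  \<open>h t = \<mu> t * exp (- M(t, t + l))\<close>. A gap that starts near \<open>t\<close> needs a point there and none in
  the following window of length \<open>l\<close>, so \<open>h\<close> is roughly the hazard rate of \<open>D\<close>, and
  \<open>- ln (u t)\<close> should grow like the integral of \<open>h\<close>. Two facts make this precise.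

  First, \<open>D > t\<close> is an increasing event: further points only shorten gaps. Hence it is positively
  correlated with the event that a given set contains a point (\<open>gapless_hit_ge\<close>). For \<open>a < b\<close> close together, a point
  in \<open>(a, b]\<close> followed by an empty window starts a gap, and this window is independent of what
  precedes it, so the correlation inequality bounds \<open>u a - u b\<close> from below by about
  \<open>u a * M(a, b) * exp (- M(b, b + l))\<close> (\<open>survival_decrease_ge\<close>).

  Second, a gap starting in \<open>(a, b]\<close> needs a point there, an empty \<open>(b, a + l)\<close>, and \<open>D > a - l\<close>;
  the last event depends only on the points before \<open>a\<close>. So \<open>u a - u b\<close> is at most about
  \<open>u (a - l) * M(a, b) * exp (- M(b, a + l))\<close> (\<open>survival_decrease_le\<close>). The factor \<open>u (a - l)\<close> may be replaced by
  \<open>u a\<close> up to a factor close to 1: by the correlation inequality again, \<open>D\<close> survives a further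
  half window with probability at least that of a point in the next half window, which tends to 1
  as \<open>\<mu>\<close> tends to infinity (\<open>survival_half_step\<close>).

  Both estimates are local in time, and a bisection argument integrates them to estimates of
  \<open>ln (u t)\<close> by the integral of \<open>h\<close> (\<open>ln_decay_ge\<close>, \<open>ln_decay_le\<close>). The latter diverges by assumption, which absorbs all
  additive constants. Finally \<open>M(t, t + l) = l * \<mu> t + o(1)\<close> gives that \<open>h t\<close> is asymptotic to
  \<open>exp (- l * \<mu> t) * \<mu> t\<close>, so the integral of \<open>h\<close> may be replaced by \<open>f\<close>.

  Independence comes from the void probabilities \<open>P (N \<inter> B = {}) = exp (- \<Lambda> B)\<close>: additivity
  of \<open>\<Lambda>\<close> makes the void events of disjoint sets independent, and this extends to the
  \<open>\<sigma>\<close>-algebras generated by the void events of disjoint regions (\<open>history_indep_void\<close>).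
  Survival up to \<open>t\<close> belongs to such a \<open>\<sigma>\<close>-algebra because it can be tested on countably many
  grids (\<open>gapless_in_history\<close>).
\<close>

section \<open>Gaps of a locally finite point set\<close>

text \<open>
  The origin counts as the start of a gap, in line with \<open>T\<^sub>0 = 0\<close>.
\<close>
definition gapless :: "real \<Rightarrow> real \<Rightarrow> real set \<Rightarrow> bool" where
  "gapless l t S \<longleftrightarrow> (\<forall>s\<in>insert 0 S. s \<le> t \<longrightarrow> S \<inter> {s<..<s + l} \<noteq> {})"

definition point_configuration :: "real set \<Rightarrow> bool" where
  "point_configuration S \<longleftrightarrow> S \<subseteq> {0<..} \<and> (\<forall>t. finite (S \<inter> {..t}))"

lemma point_configuration_subset:
  assumes "point_configuration S" "S' \<subseteq> S"
  shows "point_configuration S'"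
  using assms unfolding point_configuration_def
  by (meson Int_mono finite_subset order_refl order_trans)

lemma epoch_finite_imp_point:
  assumes "point_configuration S" "epoch S n < \<infinity>"
  shows "\<exists>s\<in>insert 0 S. epoch S n = ereal s"
proof (cases n)
  case 0
  then show ?thesis by (auto simp: zero_ereal_def)
next
  case (Suc k)
  let ?A = "{ereal x | x. x \<in> S \<and> epoch S k < ereal x}"
  have "?A \<noteq> {}"
  proof
    assume "?A = {}"
    then have "Inf ?A = \<infinity>" by (simp only: Inf_empty top_ereal_def)
    then show False using assms(2) Suc by simp
  qed
  then obtain y where y: "y \<in> S" "epoch S k < ereal y" by auto
  let ?F = "ereal ` {x \<in> S \<inter> {..y}. epoch S k < ereal x}"
  have fin: "finite ?F"
    using assms(1) unfolding point_configuration_def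
    by (intro finite_imageI) (rule finite_subset[of _ "S \<inter> {..y}"], auto)
  have ne: "?F \<noteq> {}" using y by auto
  have "Inf ?A = Min ?F"
  proof (rule antisym)
    show "Inf ?A \<le> Min ?F"
      using Min_in[OF fin ne] by (intro Inf_lower) auto
    show "Min ?F \<le> Inf ?A"
    proof (rule Inf_greatest)
      fix z assume "z \<in> ?A"
      then obtain x where x: "z = ereal x" "x \<in> S" "epoch S k < ereal x" by auto
      show "Min ?F \<le> z"
      proof (cases "x \<le> y")
        case True
        then show ?thesis using x fin by (intro Min_le) auto
      next
        case False
        have "Min ?F \<le> ereal y" using y fin by (intro Min_le) auto
        also have "\<dots> \<le> z" using False x by simp
        finally show ?thesis .
      qed
    qed
  qed
  moreover have "Min ?F \<in> ?F" by (rule Min_in[OF fin ne])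
  ultimately show ?thesis using Suc by auto
qed

lemma point_imp_epoch:
  assumes S: "point_configuration S" and "s \<in> insert 0 S"
  shows "\<exists>n. epoch S n = ereal s"
  using assms(2)
proof (induction "card (S \<inter> {..<s})" arbitrary: s rule: less_induct)
  case less
  show ?case
  proof (cases "s = 0")
    case True
    then show ?thesis by (intro exI[of _ 0]) (simp add: zero_ereal_def)
  next
    case False
    then have s: "s \<in> S" "0 < s" using less.prems S by (auto simp: point_configuration_def)
    have fin: "finite (S \<inter> {..<s})"
      using S by (rule_tac finite_subset[of _ "S \<inter> {..s}"]) (auto simp: point_configuration_def)
    define r where "r = Max (insert 0 (S \<inter> {..<s}))"
    have r_in: "r \<in> insert 0 (S \<inter> {..<s})" unfolding r_def using fin by (intro Max_in) auto
    have r_max: "x \<le> r" if "x \<in> S" "x < s" for x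
      unfolding r_def using fin that by (intro Max_ge) auto
    have rs: "r < s" using r_in s by auto
    \<comment> \<open>The point that precedes \<open>s\<close> is an epoch, and \<open>s\<close> is the next one.\<close>
    have "\<exists>n. epoch S n = ereal r"
    proof (cases "r = 0")
      case True
      then show ?thesis by (intro exI[of _ 0]) (simp add: zero_ereal_def)
    next
      case False
      then have "r \<in> S \<inter> {..<s}" using r_in by auto
      then have "card (S \<inter> {..<r}) < card (S \<inter> {..<s})"
        using rs fin by (intro psubset_card_mono) auto
      then show ?thesis using less.hyps[of r] r_in by auto
    qed
    then obtain n where n: "epoch S n = ereal r" by auto
    have "epoch S (Suc n) = ereal s"
    proof (simp add: n, rule antisym)
      show "Inf {ereal x |x. x \<in> S \<and> r < x} \<le> ereal s"
        using s rs by (intro Inf_lower) auto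
      show "ereal s \<le> Inf {ereal x |x. x \<in> S \<and> r < x}"
        using r_max by (intro Inf_greatest) (auto simp: not_less[symmetric])
    qed
    then show ?thesis by blast
  qed
qed

text \<open>
  The epochs enumerate exactly the origin and the points, and the next epoch is the infimum of the
  later points; so the epochs can be dispensed with.
\<close>
lemma gap_start_eq:
  assumes S: "point_configuration S"
  shows "gap_start l S = Inf (ereal ` {s \<in> insert 0 S. S \<inter> {s<..<s + l} = {}})"
proof -
  have gap_iff: "ereal l \<le> epoch S (Suc n) - epoch S n \<longleftrightarrow> S \<inter> {s<..<s + l} = {}"
    if "epoch S n = ereal s" for n s
  proof -
    have "ereal l \<le> epoch S (Suc n) - ereal s \<longleftrightarrow> ereal (s + l) \<le> epoch S (Suc n)"
      by (cases "epoch S (Suc n)") (auto simp: algebra_simps)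
    also have "\<dots> \<longleftrightarrow> (\<forall>x\<in>S. s < x \<longrightarrow> s + l \<le> x)"
      using that by (auto simp: le_Inf_iff)
    also have "\<dots> \<longleftrightarrow> S \<inter> {s<..<s + l} = {}"
      by (auto simp: disjoint_iff not_le)
    finally show ?thesis using that by simp
  qed
  have "{epoch S n | n. epoch S n < \<infinity> \<and> ereal l \<le> epoch S (Suc n) - epoch S n}
      = ereal ` {s \<in> insert 0 S. S \<inter> {s<..<s + l} = {}}" (is "?L = ?R")
  proof (intro equalityI subsetI)
    fix z assume "z \<in> ?L"
    then obtain n where n: "z = epoch S n" "epoch S n < \<infinity>"
      "ereal l \<le> epoch S (Suc n) - epoch S n" by blast
    obtain s where "s \<in> insert 0 S" "epoch S n = ereal s"
      using epoch_finite_imp_point[OF S n(2)] by blast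
    then show "z \<in> ?R" using n gap_iff[of n s] by blast
  next
    fix z assume "z \<in> ?R"
    then obtain s where s: "z = ereal s" "s \<in> insert 0 S" "S \<inter> {s<..<s + l} = {}" by blast
    obtain n where "epoch S n = ereal s" using point_imp_epoch[OF S s(2)] by blast
    then show "z \<in> ?L" using s gap_iff[of n s] by (intro CollectI exI[of _ n]) auto
  qed
  then show ?thesis unfolding gap_start_def by simp
qed

text \<open>
  Only finitely many gaps start before \<open>t + 1\<close>, so the infimum exceeds \<open>t\<close> strictly as soon as
  all its members do.
\<close>
lemma less_gap_start_iff_gapless:
  assumes S: "point_configuration S"
  shows "ereal t < gap_start l S \<longleftrightarrow> gapless l t S"
proof
  assume less: "ereal t < gap_start l S"
  show "gapless l t S"
    unfolding gapless_def
  proof (intro ballI impI notI)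
    fix s assume "s \<in> insert 0 S" "s \<le> t" "S \<inter> {s<..<s + l} = {}"
    then have "gap_start l S \<le> ereal s"
      unfolding gap_start_eq[OF S] by (intro Inf_lower) auto
    then have "ereal t < ereal s" using less by (rule less_le_trans[rotated])
    then show False using \<open>s \<le> t\<close> by simp
  qed
next
  assume g: "gapless l t S"
  let ?F = "{s \<in> insert 0 S. S \<inter> {s<..<s + l} = {} \<and> s \<le> t + 1}"
  have fin: "finite ?F"
    using S by (rule_tac finite_subset[of _ "insert 0 (S \<inter> {..t + 1})"])
      (auto simp: point_configuration_def)
  let ?z = "Min (insert (t + 1) ?F)"
  have "?z \<in> insert (t + 1) ?F" using fin by (intro Min_in) auto
  then have "t < ?z" using g unfolding gapless_def by force
  also have "ereal ?z \<le> gap_start l S"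
    unfolding gap_start_eq[OF S]
  proof (rule Inf_greatest)
    fix x assume "x \<in> ereal ` {s \<in> insert 0 S. S \<inter> {s<..<s + l} = {}}"
    then obtain s where s: "x = ereal s" "s \<in> insert 0 S" "S \<inter> {s<..<s + l} = {}" by blast
    have "ereal ?z \<le> ereal s"
    proof (cases "s \<le> t + 1")
      case True
      then have "?z \<le> s" using s fin by (intro Min_le) auto
      then show ?thesis by simp
    next
      case False
      have "?z \<le> t + 1" using fin by (intro Min_le) auto
      then show ?thesis using False by simp
    qed
    then show "ereal ?z \<le> x" using s by simp
  qed
  finally show "ereal t < gap_start l S" by simp
qed

text \<open>
  Adding points never creates a gap: the last old point up to a new point \<open>s\<close> has an old successor,
  which lies beyond \<open>s\<close> and within \<open>l\<close> of it.
\<close>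
lemma gapless_mono:
  assumes S: "point_configuration S" and "S' \<subseteq> S" and g: "gapless l t S'"
  shows "gapless l t S"
  unfolding gapless_def
proof (intro ballI impI)
  fix s assume s: "s \<in> insert 0 S" "s \<le> t"
  have pos: "0 \<le> s" using s S by (auto simp: point_configuration_def)
  have fin: "finite (insert 0 (S' \<inter> {..s}))"
    using point_configuration_subset[OF S \<open>S' \<subseteq> S\<close>] by (auto simp: point_configuration_def)
  define r where "r = Max (insert 0 (S' \<inter> {..s}))"
  have r: "r \<in> insert 0 (S' \<inter> {..s})" unfolding r_def using fin by (intro Max_in) auto
  then have rs: "r \<le> s" using pos by auto
  obtain x where x: "x \<in> S'" "r < x" "x < r + l"
    using g r rs s(2) unfolding gapless_def by fastforce
  have "s < x"
  proof (rule ccontr)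
    assume "\<not> s < x"
    then have "x \<le> r" unfolding r_def using x fin by (intro Max_ge) auto
    with x show False by simp
  qed
  then show "S \<inter> {s<..<s + l} \<noteq> {}" using x rs \<open>S' \<subseteq> S\<close> by force
qed

lemma gapless_antimono_time: "gapless l b S \<Longrightarrow> a \<le> b \<Longrightarrow> gapless l a S"
  unfolding gapless_def by force

text \<open>
  For measurability, the quantification over the points has to be replaced by a countable one. A grid
  of mesh \<open>1 / (m + 1)\<close>, running backwards from \<open>t\<close>, serves this purpose: a cell that contains a
  point must be followed by a point in an interval that is contained in \<open>(s, s + l)\<close> for all \<open>s\<close> in
  the cell, while the gap that starts at the origin is treated separately. This condition is sufficient for every mesh, and it is necessary for a fine mesh because
  only finitely many points lie up to \<open>t\<close>.
\<close>
lemma gapless_grid_iff: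
  assumes S: "point_configuration S" and t: "0 \<le> t"
  shows "gapless l t S \<longleftrightarrow> S \<inter> {0<..<l} \<noteq> {} \<and>
    (\<exists>m::nat. \<forall>i::nat. S \<inter> {t - real (Suc i) / real (Suc m)<..t - real i / real (Suc m)} = {} \<or>
       S \<inter> {t - real i / real (Suc m)<..<t - real (Suc i) / real (Suc m) + l} \<noteq> {})"
    (is "_ \<longleftrightarrow> _ \<and> (\<exists>m. \<forall>i. S \<inter> ?C m i = {} \<or> S \<inter> ?E m i \<noteq> {})")
proof
  assume g: "gapless l t S"
  have fin: "finite (S \<inter> {..t})" using S by (auto simp: point_configuration_def)
  have "\<forall>s\<in>S \<inter> {..t}. \<exists>x. x \<in> S \<inter> {s<..<s + l}"
    using g unfolding gapless_def by blast
  then obtain nxt where nxt: "\<And>s. s \<in> S \<inter> {..t} \<Longrightarrow> nxt s \<in> S \<inter> {s<..<s + l}"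
    using bchoice[of "S \<inter> {..t}" "\<lambda>s x. x \<in> S \<inter> {s<..<s + l}"] by blast
  \<comment> \<open>The smallest slack of the gaps that start up to \<open>t\<close>; a mesh below it is fine enough.\<close>
  define \<delta> where "\<delta> = Min (insert 1 ((\<lambda>s. s + l - nxt s) ` (S \<inter> {..t})))"
  have "\<delta> \<in> insert 1 ((\<lambda>s. s + l - nxt s) ` (S \<inter> {..t}))"
    unfolding \<delta>_def using fin by (intro Min_in) auto
  then have "0 < \<delta>" using nxt by fastforce
  then obtain m where m: "inverse (real (Suc m)) < \<delta>" using reals_Archimedean by blast
  have "S \<inter> ?C m i = {} \<or> S \<inter> ?E m i \<noteq> {}" for i
  proof (cases "S \<inter> ?C m i = {}")
    case False
    have Ct: "?C m i \<subseteq> {..t}" by (auto intro: order_trans)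
    then have finC: "finite (S \<inter> ?C m i)" using fin by (rule_tac finite_subset) auto
    \<comment> \<open>The successor of the last point of the cell lies beyond the cell.\<close>
    define s where "s = Max (S \<inter> ?C m i)"
    have s: "s \<in> S \<inter> ?C m i" unfolding s_def using False finC by (intro Max_in) auto
    then have s': "s \<in> S \<inter> {..t}" using Ct by auto
    have n: "nxt s \<in> S" "s < nxt s" using nxt[OF s'] by auto
    have "\<delta> \<le> s + l - nxt s"
      unfolding \<delta>_def using fin s' by (intro Min_le) auto
    moreover have "t - real (Suc i) / real (Suc m) = t - real i / real (Suc m) - inverse (real (Suc m))"
      by (simp add: add_divide_distrib inverse_eq_divide del: of_nat_Suc) (simp add: add_divide_distrib)
    ultimately have "nxt s < t - real (Suc i) / real (Suc m) + l" using m s by simp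
    moreover have "t - real i / real (Suc m) < nxt s"
    proof (rule ccontr)
      assume "\<not> ?thesis"
      then have "nxt s \<in> S \<inter> ?C m i" using n s by auto
      then have "nxt s \<le> s" unfolding s_def using finC by (intro Max_ge) auto
      with n show False by simp
    qed
    ultimately show ?thesis using n by auto
  qed auto
  moreover have "S \<inter> {0<..<l} \<noteq> {}" using g t unfolding gapless_def by force
  ultimately show "S \<inter> {0<..<l} \<noteq> {} \<and> (\<exists>m. \<forall>i. S \<inter> ?C m i = {} \<or> S \<inter> ?E m i \<noteq> {})" by blast
next
  assume "S \<inter> {0<..<l} \<noteq> {} \<and> (\<exists>m. \<forall>i. S \<inter> ?C m i = {} \<or> S \<inter> ?E m i \<noteq> {})"
  then obtain m where first: "S \<inter> {0<..<l} \<noteq> {}"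
    and m: "\<And>i. S \<inter> ?C m i = {} \<or> S \<inter> ?E m i \<noteq> {}" by blast
  show "gapless l t S"
    unfolding gapless_def
  proof (intro ballI impI)
    fix s assume s: "s \<in> insert 0 S" "s \<le> t"
    show "S \<inter> {s<..<s + l} \<noteq> {}"
    proof (cases "s = 0")
      case True
      then show ?thesis using first by simp
    next
      case False
      define i where "i = nat \<lfloor>(t - s) * real (Suc m)\<rfloor>"
      have "real i \<le> (t - s) * real (Suc m)" "(t - s) * real (Suc m) < real (Suc i)"
        using s(2) unfolding i_def by (auto simp: floor_le_iff) linarith+
      then have i: "real i / real (Suc m) \<le> t - s" "t - s < real (Suc i) / real (Suc m)"
        by (simp_all add: divide_le_eq less_divide_eq del: of_nat_Suc)
      then have "S \<inter> ?C m i \<noteq> {}" using s False by force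
      then have "S \<inter> ?E m i \<noteq> {}" using m by blast
      then show ?thesis using i by force
    qed
  qed
qed

section \<open>Survival without gaps, from void probabilities\<close>

text \<open>
  A simple point process given through its void probabilities, which determine its law.
\<close>
locale void_process = prob_space P for P :: "'w measure" +
  fixes N :: "'w \<Rightarrow> real set" and \<Lambda> :: "real measure"
  assumes configuration: "\<omega> \<in> space P \<Longrightarrow> point_configuration (N \<omega>)"
    and sets_intensity: "B \<in> sets borel \<Longrightarrow> B \<in> sets \<Lambda>"
    and intensity_finite: "B \<in> sets borel \<Longrightarrow> bounded B \<Longrightarrow> emeasure \<Lambda> B \<noteq> \<infinity>"
    and void_event: "B \<in> sets borel \<Longrightarrow> bounded B \<Longrightarrow> {\<omega> \<in> space P. N \<omega> \<inter> B = {}} \<in> events"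
    and void_prob: "B \<in> sets borel \<Longrightarrow> bounded B \<Longrightarrow>
      prob {\<omega> \<in> space P. N \<omega> \<inter> B = {}} = exp (- measure \<Lambda> B)"
begin

abbreviation void :: "real set \<Rightarrow> 'w set" where
  "void B \<equiv> {\<omega> \<in> space P. N \<omega> \<inter> B = {}}"

abbreviation hit :: "real set \<Rightarrow> 'w set" where
  "hit B \<equiv> {\<omega> \<in> space P. N \<omega> \<inter> B \<noteq> {}}"

text \<open>
  The information carried by the points in \<open>B\<close>. Taking void events as generators keeps the generating
  family closed under intersection.
\<close>
definition history :: "real set \<Rightarrow> 'w set set" where
  "history B = sigma_sets (space P) {void J | J. J \<in> sets borel \<and> bounded J \<and> J \<subseteq> B}"

lemma sigma_algebra_history: "sigma_algebra (space P) (history B)"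
  unfolding history_def by (rule sigma_algebra_sigma_sets) auto

lemma void_in_history: "J \<in> sets borel \<Longrightarrow> bounded J \<Longrightarrow> J \<subseteq> B \<Longrightarrow> void J \<in> history B"
  unfolding history_def by (rule sigma_sets.Basic) auto

lemma hit_in_history: 
  assumes "J \<in> sets borel" "bounded J" "J \<subseteq> B"
  shows "hit J \<in> history B"
proof -
  interpret H: sigma_algebra "space P" "history B" by (rule sigma_algebra_history)
  have "hit J = space P - void J" by auto
  then show ?thesis using void_in_history[OF assms] by auto
qed

lemma history_mono: "B \<subseteq> C \<Longrightarrow> history B \<subseteq> history C"
  unfolding history_def by (rule sigma_sets_mono') auto

lemma history_events: "A \<in> history B \<Longrightarrow> A \<in> events"
  unfolding history_def
  using sets.sigma_sets_subset[of "{void J | J. J \<in> sets borel \<and> bounded J \<and> J \<subseteq> B}" P] void_event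
  by blast

lemma prob_hit: "J \<in> sets borel \<Longrightarrow> bounded J \<Longrightarrow> prob (hit J) = 1 - exp (- measure \<Lambda> J)"
proof -
  assume J: "J \<in> sets borel" "bounded J"
  have "hit J = space P - void J" by auto
  then show ?thesis using prob_compl[OF void_event[OF J]] void_prob[OF J] by simp
qed

lemma void_disjoint:
  assumes J: "J \<in> sets borel" "bounded J" and K: "K \<in> sets borel" "bounded K" and "J \<inter> K = {}"
  shows "prob (void J \<inter> void K) = prob (void J) * prob (void K)"
proof -
  have "void J \<inter> void K = void (J \<union> K)" by auto
  moreover have "measure \<Lambda> (J \<union> K) = measure \<Lambda> J + measure \<Lambda> K"
    using J K assms(5) intensity_finite sets_intensity
    by (intro measure_Union) auto
  ultimately show ?thesis
    using J K void_prob[of "J \<union> K"] void_prob[of J] void_prob[of K]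
    by (simp add: exp_add[symmetric])
qed

text \<open>
  The generating void events form a \<open>\<pi>\<close>-system, since \<open>void J \<inter> void J' = void (J \<union> J')\<close>; on them
  independence is the additivity of \<open>\<Lambda>\<close>, and Dynkin's lemma does the rest.
\<close>
lemma history_indep_void:
  assumes A: "A \<in> history B" and K: "K \<in> sets borel" "bounded K" and disj: "B \<inter> K = {}"
  shows "prob (A \<inter> void K) = prob A * prob (void K)"
proof -
  let ?G = "{void J | J. J \<in> sets borel \<and> bounded J \<and> J \<subseteq> B}"
  have "Int_stable ?G"
  proof (rule Int_stableI, safe)
    fix J J' assume J: "J \<in> sets borel" "bounded J" "J \<subseteq> B" "J' \<in> sets borel" "bounded J'" "J' \<subseteq> B"
    have "void J \<inter> void J' = void (J \<union> J')" by auto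
    then show "\<exists>L. void J \<inter> void J' = void L \<and> L \<in> sets borel \<and> bounded L \<and> L \<subseteq> B"
      using J by (intro exI[of _ "J \<union> J'"]) auto
  qed
  moreover have "?G \<subseteq> Pow (space P)" by auto
  moreover have "A \<in> sigma_sets (space P) ?G" using A unfolding history_def .
  moreover have sub: "X \<in> events" if "X \<in> sigma_sets (space P) ?G" for X
    using that history_events[of X B] unfolding history_def by blast
  ultimately show ?thesis
  proof (induction rule: sigma_sets_induct_disjoint)
    case (basic X)
    then obtain J where J: "X = void J" "J \<in> sets borel" "bounded J" "J \<subseteq> B" by blast
    then show ?case using void_disjoint[of J K] K disj by auto
  next
    case empty
    then show ?case by simp
  next
    case (compl X)
    have X: "X \<in> events" using compl sub by blast
    have vK: "void K \<in> events" using void_event[OF K] .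
    have "(space P - X) \<inter> void K = void K - X \<inter> void K" by auto
    then have "prob ((space P - X) \<inter> void K) = prob (void K) - prob (X \<inter> void K)"
      using X vK by (simp add: finite_measure_Diff)
    then show ?case using compl prob_compl[OF X] by (simp add: left_diff_distrib)
  next
    case (union F)
    have ev: "F i \<in> events" for i using union sub by auto
    have vK: "void K \<in> events" using void_event[OF K] .
    have "(\<lambda>i. prob (F i)) sums prob (\<Union>i. F i)"
      using ev union by (intro finite_measure_UNION) auto
    then have "(\<lambda>i. prob (F i) * prob (void K)) sums (prob (\<Union>i. F i) * prob (void K))"
      by (rule sums_mult2)
    moreover have "(\<lambda>i. prob (F i \<inter> void K)) sums prob (\<Union>i. F i \<inter> void K)"
      using ev vK union by (intro finite_measure_UNION) (auto simp: disjoint_family_on_def)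
    moreover have "(\<Union>i. F i \<inter> void K) = (\<Union>i. F i) \<inter> void K" by auto
    ultimately show ?case using union by (simp add: sums_unique2)
  qed
qed

lemma history_indep_hit:
  assumes A: "A \<in> history B" and K: "K \<in> sets borel" "bounded K" and disj: "B \<inter> K = {}"
  shows "prob (A \<inter> hit K) = prob A * prob (hit K)"
proof -
  have "A \<inter> hit K = A - A \<inter> void K" using history_events[OF A] sets.sets_into_space by blast
  then have "prob (A \<inter> hit K) = prob A - prob (A \<inter> void K)"
    using history_events[OF A] void_event[OF K] by (simp add: finite_measure_Diff)
  then show ?thesis
    using history_indep_void[OF A K disj] prob_hit[OF K] void_prob[OF K]
    by (simp add: right_diff_distrib)
qed

text \<open>
  Thinning by an arbitrary \<open>B\<close> is included so that the lemma also covers the process with a block of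
  points deleted or with the future cut off.
\<close>
lemma gapless_in_history:
  assumes B: "B \<in> sets borel" and t: "0 \<le> t"
  shows "{\<omega> \<in> space P. gapless l t (N \<omega> \<inter> B)} \<in> history (B \<inter> {0<..<t + l})"
proof -
  let ?H = "history (B \<inter> {0<..<t + l})"
  interpret H: sigma_algebra "space P" ?H by (rule sigma_algebra_history)
  define C where "C m i = {t - real (Suc i) / real (Suc m)<..t - real i / real (Suc m)}" for m i :: nat
  define E where "E m i = {t - real i / real (Suc m)<..<t - real (Suc i) / real (Suc m) + l}" for m i :: nat
  show ?thesis
  proof (cases "0 < l")
    case l: True
    have within: "{t - q<..t - p} \<inter> {0<..} \<subseteq> {0<..<t + l}" "{t - p<..<t - q + l} \<inter> {0<..} \<subseteq> {0<..<t + l}"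
      if "0 \<le> p" "0 \<le> q" for p q
      using that l by auto
    have CE: "C m i \<inter> {0<..} \<subseteq> {0<..<t + l}" "E m i \<inter> {0<..} \<subseteq> {0<..<t + l}" for m i
      unfolding C_def E_def by (rule within; simp)+
    have meas: "void (B \<inter> J \<inter> {0<..}) \<in> ?H" "hit (B \<inter> J \<inter> {0<..}) \<in> ?H"
      if "J \<in> sets borel" "J \<inter> {0<..} \<subseteq> {0<..<t + l}" for J
    proof -
      have "bounded (B \<inter> J \<inter> {0<..})"
        by (rule bounded_subset[of "{0<..<t + l}"]) (use that in auto)
      moreover have "B \<inter> J \<inter> {0<..} \<in> sets borel" using that B by auto
      ultimately show "void (B \<inter> J \<inter> {0<..}) \<in> ?H" "hit (B \<inter> J \<inter> {0<..}) \<in> ?H"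
        using that by (auto intro!: void_in_history hit_in_history)
    qed
    have pos: "N \<omega> \<subseteq> {0<..}" if "\<omega> \<in> space P" for \<omega>
      using configuration[OF that] by (simp add: point_configuration_def)
    have "{\<omega> \<in> space P. gapless l t (N \<omega> \<inter> B)} =
      hit (B \<inter> {0<..<l} \<inter> {0<..}) \<inter>
        (\<Union>m. \<Inter>i. void (B \<inter> C m i \<inter> {0<..}) \<union> hit (B \<inter> E m i \<inter> {0<..}))" (is "?L = ?R")
    proof (rule set_eqI)
      fix \<omega>
      show "\<omega> \<in> ?L \<longleftrightarrow> \<omega> \<in> ?R"
      proof (cases "\<omega> \<in> space P")
        case True
        have cfg: "point_configuration (N \<omega> \<inter> B)"
          using configuration[OF True] by (rule point_configuration_subset) auto
        have "N \<omega> \<inter> (B \<inter> J \<inter> {0<..}) = N \<omega> \<inter> B \<inter> J" for J using pos[OF True] by auto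
        then show ?thesis
          using True gapless_grid_iff[OF cfg t, of l] by (simp add: C_def E_def del: of_nat_Suc)
      qed auto
    qed
    also have "\<dots> \<in> ?H"
      by (intro H.Int H.countable_UN H.countable_INT H.Un image_subsetI meas CE)
        (use t in \<open>auto simp: C_def E_def\<close>)
    finally show ?thesis .
  next
    case False
    then have "{\<omega> \<in> space P. gapless l t (N \<omega> \<inter> B)} = {}"
      using t by (auto simp: gapless_def)
    then show ?thesis by (simp only: H.empty_sets)
  qed
qed

definition survival :: "real \<Rightarrow> real \<Rightarrow> real" where
  "survival l t = prob {\<omega> \<in> space P. gapless l t (N \<omega>)}"

lemma gapless_event: "0 \<le> t \<Longrightarrow> {\<omega> \<in> space P. gapless l t (N \<omega>)} \<in> events"
  using history_events[OF gapless_in_history[of UNIV t l]] by simp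

text \<open>
  An instance of the Harris correlation inequality. If \<open>J\<close> is void, then survival is survival of the
  process with \<open>J\<close> deleted; this is independent of \<open>J\<close> being void and, by monotonicity, no more
  likely than survival itself. So survival and the voidness of \<open>J\<close> are negatively correlated.
\<close>
lemma gapless_hit_ge:
  assumes t: "0 \<le> t" and J: "J \<in> sets borel" "bounded J"
  shows "survival l t * prob (hit J) \<le> prob ({\<omega> \<in> space P. gapless l t (N \<omega>)} \<inter> hit J)"
proof -
  let ?A = "{\<omega> \<in> space P. gapless l t (N \<omega>)}"
  let ?A' = "{\<omega> \<in> space P. gapless l t (N \<omega> \<inter> - J)}"
  have A: "?A \<in> events" using t by (rule gapless_event)
  have A': "?A' \<in> history (- J)"
    using gapless_in_history[of "- J" t l] t J history_mono[of "- J \<inter> {0<..<t + l}" "- J"] by auto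
  have "?A \<inter> void J = ?A' \<inter> void J"
  proof -
    have "N \<omega> \<inter> - J = N \<omega>" if "N \<omega> \<inter> J = {}" for \<omega> using that by auto
    then show ?thesis by auto
  qed
  then have "prob (?A \<inter> void J) = prob ?A' * prob (void J)"
    using history_indep_void[OF A' J] by simp
  also have "\<dots> \<le> prob ?A * prob (void J)"
  proof (intro mult_right_mono finite_measure_mono A)
    show "?A' \<subseteq> ?A" using configuration by (auto intro: gapless_mono[of "N \<omega>" "N \<omega> \<inter> - J" for \<omega>])
  qed simp
  finally have "prob (?A \<inter> void J) \<le> prob ?A * prob (void J)" .
  moreover have "prob (?A \<inter> hit J) = prob ?A - prob (?A \<inter> void J)"
  proof -
    have "?A \<inter> hit J = ?A - ?A \<inter> void J" by auto
    then show ?thesis using A void_event[OF J] by (simp add: finite_measure_Diff)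
  qed
  moreover have "prob (hit J) = 1 - prob (void J)" using prob_hit[OF J] void_prob[OF J] by simp
  ultimately show ?thesis unfolding survival_def by (simp add: right_diff_distrib)
qed

text \<open>
  Once \<open>(a, b]\<close> contains a point, survival up to \<open>a\<close> is decided by the points up to \<open>b\<close>, and it is
  therefore independent of the voidness of \<open>(b, b + l)\<close>. If the latter set is void, then the last point
  of \<open>(a, b]\<close> starts a gap.
\<close>
lemma survival_decrease_ge:
  assumes "0 \<le> a" "a < b" "0 < l"
  shows "survival l a * (1 - exp (- measure \<Lambda> {a<..b})) * exp (- measure \<Lambda> {b<..<b + l})
    \<le> survival l a - survival l b"
proof -
  let ?A = "{\<omega> \<in> space P. gapless l a (N \<omega>)}"
  let ?B = "{\<omega> \<in> space P. gapless l b (N \<omega>)}"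
  let ?X = "{\<omega> \<in> space P. gapless l a (N \<omega> \<inter> {..b})} \<inter> hit {a<..b}"
  let ?J = "{a<..b}" and ?K = "{b<..<b + l}"
  interpret H: sigma_algebra "space P" "history {..b}" by (rule sigma_algebra_history)
  have "{\<omega> \<in> space P. gapless l a (N \<omega> \<inter> {..b})} \<in> history {..b}"
    using gapless_in_history[of "{..b}" a l] assms history_mono[of "{..b} \<inter> {0<..<a + l}" "{..b}"] by auto
  then have X: "?X \<in> history {..b}" by (intro H.Int hit_in_history) auto
  have cut: "gapless l a (N \<omega> \<inter> {..b}) \<longleftrightarrow> gapless l a (N \<omega>)"
    if \<omega>: "\<omega> \<in> space P" and hit: "N \<omega> \<inter> ?J \<noteq> {}" for \<omega>
  proof
    assume "gapless l a (N \<omega> \<inter> {..b})"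
    then show "gapless l a (N \<omega>)" by (rule gapless_mono[OF configuration[OF \<omega>], rotated]) auto
  next
    assume g: "gapless l a (N \<omega>)"
    show "gapless l a (N \<omega> \<inter> {..b})"
      unfolding gapless_def
    proof (intro ballI impI)
      fix s assume s: "s \<in> insert 0 (N \<omega> \<inter> {..b})" "s \<le> a"
      then obtain r where r: "r \<in> N \<omega>" "s < r" "r < s + l" using g unfolding gapless_def by fastforce
      obtain j where j: "j \<in> N \<omega>" "a < j" "j \<le> b" using hit by auto
      show "N \<omega> \<inter> {..b} \<inter> {s<..<s + l} \<noteq> {}"
        using r j s(2) by (cases "r \<le> b") force+
    qed
  qed
  have X_eq: "?X = ?A \<inter> hit ?J" using cut by auto
  have "survival l a * prob (hit ?J) * prob (void ?K) \<le> prob ?X * prob (void ?K)"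
    unfolding X_eq using assms by (intro mult_right_mono gapless_hit_ge) auto
  also have "\<dots> = prob (?X \<inter> void ?K)"
    by (rule history_indep_void[OF X, symmetric]) auto
  also have "\<dots> \<le> prob (?A - ?B)"
  proof (rule finite_measure_mono)
    show "?X \<inter> void ?K \<subseteq> ?A - ?B"
    proof
      fix \<omega> assume \<omega>: "\<omega> \<in> ?X \<inter> void ?K"
      then have A: "\<omega> \<in> ?A" using X_eq by blast
      have fin: "finite (N \<omega> \<inter> ?J)"
        using configuration[of \<omega>] \<omega>
        by (rule_tac finite_subset[of _ "N \<omega> \<inter> {..b}"]) (auto simp: point_configuration_def)
      define s where "s = Max (N \<omega> \<inter> ?J)"
      have s: "s \<in> N \<omega> \<inter> ?J" unfolding s_def using fin \<omega> by (intro Max_in) auto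
      have "N \<omega> \<inter> {s<..<s + l} = {}"
      proof (rule ccontr)
        assume "N \<omega> \<inter> {s<..<s + l} \<noteq> {}"
        then obtain x where x: "x \<in> N \<omega>" "s < x" "x < s + l" by auto
        show False
        proof (cases "x \<le> b")
          case True
          then have "x \<le> s" unfolding s_def using x s fin by (intro Max_ge) auto
          then show False using x by simp
        next
          case False
          then have "x \<in> N \<omega> \<inter> ?K" using x s by auto
          then show False using \<omega> by blast
        qed
      qed
      then have "\<not> gapless l b (N \<omega>)" using s unfolding gapless_def by auto
      then show "\<omega> \<in> ?A - ?B" using A by simp
    qed
    show "?A - ?B \<in> events" using assms gapless_event by auto
  qed
  also have "\<dots> = survival l a - survival l b"
    unfolding survival_def using assms gapless_event gapless_antimono_time[of l b _ a]
    by (intro finite_measure_Diff) auto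
  finally show ?thesis
    by (simp add: prob_hit void_prob)
qed

text \<open>
  Going back to \<open>a - l\<close> makes survival independent of the points from \<open>a\<close> onwards.
\<close>
lemma survival_decrease_le:
  assumes "0 \<le> a - l" "a < b" "b < a + l"
  shows "survival l a - survival l b \<le>
    survival l (a - l) * (1 - exp (- measure \<Lambda> {a<..b})) * exp (- measure \<Lambda> {b<..<a + l})"
proof -
  let ?A = "{\<omega> \<in> space P. gapless l a (N \<omega>)}"
  let ?B = "{\<omega> \<in> space P. gapless l b (N \<omega>)}"
  let ?Y = "{\<omega> \<in> space P. gapless l (a - l) (N \<omega>)}"
  let ?J = "{a<..b}" and ?K = "{b<..<a + l}"
  interpret H: sigma_algebra "space P" "history {..b}" by (rule sigma_algebra_history)
  have Y: "?Y \<in> history {0<..<a}"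
    using gapless_in_history[of UNIV "a - l" l] assms by simp
  then have Yb: "?Y \<in> history {..b}" using history_mono[of "{0<..<a}" "{..b}"] assms by fastforce
  then have X: "?Y \<inter> hit ?J \<in> history {..b}" by (intro H.Int hit_in_history) auto
  have "survival l a - survival l b = prob (?A - ?B)"
    unfolding survival_def using assms gapless_event gapless_antimono_time[of l b _ a]
    by (intro finite_measure_Diff[symmetric]) auto
  also have "\<dots> \<le> prob (?Y \<inter> hit ?J \<inter> void ?K)"
  proof (rule finite_measure_mono)
    show "?A - ?B \<subseteq> ?Y \<inter> hit ?J \<inter> void ?K"
    proof
      fix \<omega> assume \<omega>: "\<omega> \<in> ?A - ?B"
      then obtain s where s: "s \<in> insert 0 (N \<omega>)" "s \<le> b" "N \<omega> \<inter> {s<..<s + l} = {}"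
        unfolding gapless_def by blast
      have "a < s" using \<omega> s unfolding gapless_def by force
      then have "s \<in> N \<omega> \<inter> ?J" and "N \<omega> \<inter> ?K = {}" using s assms by auto
      moreover have "gapless l (a - l) (N \<omega>)"
        using \<omega> gapless_antimono_time[of l a "N \<omega>" "a - l"] assms by auto
      ultimately show "\<omega> \<in> ?Y \<inter> hit ?J \<inter> void ?K" using \<omega> by auto
    qed
    show "?Y \<inter> hit ?J \<inter> void ?K \<in> events"
      using history_events[OF X] void_event[of ?K] by auto
  qed
  also have "\<dots> = prob (?Y \<inter> hit ?J) * prob (void ?K)"
    by (rule history_indep_void[OF X]) auto
  also have "prob (?Y \<inter> hit ?J) = prob ?Y * prob (hit ?J)"
    by (rule history_indep_hit[OF Y]) auto
  finally show ?thesis by (simp add: prob_hit void_prob survival_def)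
qed

text \<open>
  A point in \<open>(a + l / 2, a + l)\<close> lies in the window of every start in \<open>(a, a + l / 2]\<close>.
\<close>
lemma survival_half_step:
  assumes "0 \<le> a" "0 < l"
  shows "survival l a * (1 - exp (- measure \<Lambda> {a + l / 2<..<a + l})) \<le> survival l (a + l / 2)"
proof -
  let ?A = "{\<omega> \<in> space P. gapless l a (N \<omega>)}"
  let ?J = "{a + l / 2<..<a + l}"
  have "survival l a * prob (hit ?J) \<le> prob (?A \<inter> hit ?J)"
    using assms by (intro gapless_hit_ge) auto
  also have "\<dots> \<le> survival l (a + l / 2)"
    unfolding survival_def
  proof (rule finite_measure_mono)
    show "?A \<inter> hit ?J \<subseteq> {\<omega> \<in> space P. gapless l (a + l / 2) (N \<omega>)}"
    proof safe
      fix \<omega> j assume g: "gapless l a (N \<omega>)" and j: "j \<in> N \<omega>" "j \<in> ?J"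
      show "gapless l (a + l / 2) (N \<omega>)"
        unfolding gapless_def
      proof (intro ballI impI)
        fix s assume s: "s \<in> insert 0 (N \<omega>)" "s \<le> a + l / 2"
        show "N \<omega> \<inter> {s<..<s + l} \<noteq> {}"
        proof (cases "s \<le> a")
          case True
          then show ?thesis using g s unfolding gapless_def by blast
        next
          case False
          then have "j \<in> {s<..<s + l}" using j s by auto
          then show ?thesis using j by blast
        qed
      qed
    qed
    show "{\<omega> \<in> space P. gapless l (a + l / 2) (N \<omega>)} \<in> events"
      using assms by (intro gapless_event) auto
  qed
  finally show ?thesis by (simp add: prob_hit)
qed

lemma survival_zero: "0 < l \<Longrightarrow> 1 - exp (- measure \<Lambda> {0<..<l}) \<le> survival l 0"
proof -
  assume "0 < l"
  have "prob (hit {0<..<l}) \<le> survival l 0"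
    unfolding survival_def
  proof (rule finite_measure_mono)
    show "hit {0<..<l} \<subseteq> {\<omega> \<in> space P. gapless l 0 (N \<omega>)}"
      using configuration by (force simp: gapless_def point_configuration_def)
  qed (simp add: gapless_event)
  then show ?thesis by (simp add: prob_hit)
qed

end

section \<open>Comparison of decay rates\<close>

lemma ratio_tendsto_1:
  fixes X Y :: "real \<Rightarrow> real"
  assumes Y: "filterlim Y at_top at_top"
    and XY: "\<And>\<epsilon>. 0 < \<epsilon> \<Longrightarrow> \<exists>C. \<forall>\<^sub>F t in at_top. X t \<le> C + (1 + \<epsilon>) * Y t"
    and YX: "\<And>\<epsilon>. 0 < \<epsilon> \<Longrightarrow> \<exists>C. \<forall>\<^sub>F t in at_top. Y t \<le> C + (1 + \<epsilon>) * X t"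
  shows "((\<lambda>t. X t / Y t) \<longlongrightarrow> 1) at_top"
proof (rule order_tendstoI)
  fix a :: real assume "1 < a"
  define \<epsilon> where "\<epsilon> = (a - 1) / 3"
  have \<epsilon>: "0 < \<epsilon>" "1 + 2 * \<epsilon> < a" using \<open>1 < a\<close> by (auto simp: \<epsilon>_def field_simps)
  obtain C where C: "\<forall>\<^sub>F t in at_top. X t \<le> C + (1 + \<epsilon>) * Y t" using XY \<epsilon> by blast
  have "\<forall>\<^sub>F t in at_top. max 1 (C / \<epsilon>) \<le> Y t" using Y unfolding filterlim_at_top by blast
  with C show "\<forall>\<^sub>F t in at_top. X t / Y t < a"
  proof eventually_elim
    case (elim t)
    then have Yt: "0 < Y t" "C \<le> \<epsilon> * Y t" using \<epsilon> by (auto simp: pos_divide_le_eq mult.commute)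
    then have "X t \<le> (1 + 2 * \<epsilon>) * Y t" using elim by (simp add: algebra_simps)
    also have "\<dots> < a * Y t" using \<epsilon> Yt by simp
    finally show ?case using Yt by (simp add: pos_divide_less_eq)
  qed
next
  fix a :: real assume "a < 1"
  define \<epsilon> where "\<epsilon> = (1 - a) / 3"
  have \<epsilon>: "0 < \<epsilon>" "a < 1 - 2 * \<epsilon>" using \<open>a < 1\<close> by (auto simp: \<epsilon>_def field_simps)
  obtain C where C: "\<forall>\<^sub>F t in at_top. Y t \<le> C + (1 + \<epsilon>) * X t" using YX \<epsilon> by blast
  have "\<forall>\<^sub>F t in at_top. max 1 (C / \<epsilon>) \<le> Y t" using Y unfolding filterlim_at_top by blast
  with C show "\<forall>\<^sub>F t in at_top. a < X t / Y t"
  proof eventually_elim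
    case (elim t)
    then have Yt: "0 < Y t" "C \<le> \<epsilon> * Y t" using \<epsilon> by (auto simp: pos_divide_le_eq mult.commute)
    then have "(1 - \<epsilon>) * Y t \<le> (1 + \<epsilon>) * X t" using elim by (simp add: algebra_simps)
    moreover have "(1 + \<epsilon>) * (1 - 2 * \<epsilon>) \<le> 1 - \<epsilon>" using \<epsilon> by (simp add: algebra_simps)
    then have "(1 + \<epsilon>) * (1 - 2 * \<epsilon>) * Y t \<le> (1 - \<epsilon>) * Y t" using Yt by (intro mult_right_mono) auto
    ultimately have "(1 + \<epsilon>) * ((1 - 2 * \<epsilon>) * Y t) \<le> (1 + \<epsilon>) * X t" by (simp add: mult.assoc)
    then have "(1 - 2 * \<epsilon>) * Y t \<le> X t" using \<epsilon> by simp
    moreover have "a * Y t < (1 - 2 * \<epsilon>) * Y t" using \<epsilon> Yt by simp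
    ultimately have "a * Y t < X t" by linarith
    then show ?case using Yt by (simp add: pos_less_divide_eq)
  qed
qed

text \<open>
  An eventual inequality between integrands survives integration up to an additive constant, whatever
  the lower limits are.
\<close>
lemma integral_tail_compare:
  fixes f g :: "real \<Rightarrow> real"
  assumes f: "\<And>t. f integrable_on {a..t}" and g: "\<And>t. g integrable_on {b..t}"
    and le: "\<And>t. T \<le> t \<Longrightarrow> f t \<le> k * g t"
  shows "\<exists>C. \<forall>\<^sub>F t in at_top. integral {a..t} f \<le> C + k * integral {b..t} g"
proof -
  define S where "S = max T (max a b)"
  have "integral {a..t} f \<le> (integral {a..S} f - k * integral {b..S} g) + k * integral {b..t} g"
    if t: "S \<le> t" for t
  proof -
    have "{S..t} \<subseteq> {a..t}" "{S..t} \<subseteq> {b..t}" by (auto simp: S_def)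
    then have fS: "f integrable_on {S..t}" and gS: "g integrable_on {S..t}"
      using integrable_subinterval_real[OF f[of t], of S t] integrable_subinterval_real[OF g[of t], of S t]
      by auto
    have "integral {S..t} f \<le> integral {S..t} (\<lambda>x. k * g x)"
      using fS integrable_on_cmult_left[OF gS, of k] le by (intro integral_le) (auto simp: S_def)
    then have "integral {S..t} f \<le> k * integral {S..t} g" by simp
    moreover have "integral {a..S} f + integral {S..t} f = integral {a..t} f"
      "integral {b..S} g + integral {S..t} g = integral {b..t} g"
      using t f g by (auto intro!: Henstock_Kurzweil_Integration.integral_combine simp: S_def)
    then have "integral {a..t} f = integral {a..S} f + integral {S..t} f"
      "k * integral {b..t} g = k * integral {b..S} g + k * integral {S..t} g"
      by (simp_all flip: distrib_left)
    ultimately show ?thesis by simp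
  qed
  then show ?thesis unfolding eventually_at_top_linorder by blast
qed

text \<open>
  The deterministic part of the argument. Heuristically, \<open>hazard t\<close> is the rate at which gaps start at
  time \<open>t\<close>: a point occurs at \<open>t\<close>, and the window that follows it is empty.
\<close>
locale windowed_rate =
  fixes \<mu> :: "real \<Rightarrow> real" and l :: real
  assumes l_pos: "0 < l"
    and rate_nonneg: "0 \<le> t \<Longrightarrow> 0 \<le> \<mu> t"
    and rate_integrable: "\<mu> integrable_on {0..t}"
begin

definition cum :: "real \<Rightarrow> real" where
  "cum t = integral {0..t} \<mu>"

definition window :: "real \<Rightarrow> real" where
  "window t = cum (t + l) - cum t"

definition hazard :: "real \<Rightarrow> real" where
  "hazard t = exp (- window t) * \<mu> t"

definition cum_hazard :: "real \<Rightarrow> real" where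
  "cum_hazard t = integral {0..t} hazard"

lemma rate_integrable_on: "0 \<le> a \<Longrightarrow> \<mu> integrable_on {a..b}"
  by (rule integrable_subinterval_real[OF rate_integrable[of b]]) auto

lemma rate_absolutely_integrable: "0 \<le> a \<Longrightarrow> \<mu> absolutely_integrable_on {a..b}"
  by (rule nonnegative_absolutely_integrable_1[OF rate_integrable_on]) (auto intro: rate_nonneg)

lemma cum_diff: "0 \<le> a \<Longrightarrow> a \<le> b \<Longrightarrow> integral {a..b} \<mu> = cum b - cum a"
  unfolding cum_def
  using Henstock_Kurzweil_Integration.integral_combine[of 0 a b \<mu>] rate_integrable[of b] by simp

lemma cum_mono: "0 \<le> a \<Longrightarrow> a \<le> b \<Longrightarrow> cum a \<le> cum b"
  using integral_nonneg[OF rate_integrable_on[of a b]] cum_diff[of a b] rate_nonneg by auto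

lemma continuous_on_cum: "continuous_on {0..} cum"
  unfolding continuous_on_eq_continuous_within
proof
  fix x :: real assume "x \<in> {0..}"
  have "continuous_on {0..x + 1} cum"
    unfolding cum_def by (rule indefinite_integral_continuous_1[OF rate_integrable])
  then have "continuous (at x within {0..x + 1}) cum"
    using \<open>x \<in> {0..}\<close> by (simp add: continuous_on_eq_continuous_within)
  moreover have "at x within {0..x + 1} = at x within {0..}"
    by (rule at_within_nhd[of _ "{..<x + 1}"]) auto
  ultimately show "continuous (at x within {0..}) cum" by simp
qed

lemma continuous_on_window: "continuous_on {0..} window"
  unfolding window_def using l_pos
  by (intro continuous_intros continuous_on_compose2[OF continuous_on_cum]) auto

lemma window_nonneg: "0 \<le> t \<Longrightarrow> 0 \<le> window t"
  unfolding window_def using cum_mono[of t "t + l"] l_pos by auto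

lemma bounded_multiple_integrable_on:
  assumes a: "0 \<le> a" and "\<phi> \<in> borel_measurable (lebesgue_on {a..b})"
    and "\<And>x. x \<in> {a..b} \<Longrightarrow> 0 \<le> \<phi> x \<and> \<phi> x \<le> 1"
  shows "(\<lambda>t. \<phi> t * \<mu> t) integrable_on {a..b}"
proof -
  have "bounded (\<phi> ` {a..b})" using assms(3) by (intro boundedI[of _ 1]) auto
  then have "(\<lambda>t. \<phi> t * \<mu> t) absolutely_integrable_on {a..b}"
    using assms rate_absolutely_integrable[OF a]
    by (intro absolutely_integrable_bounded_measurable_product_real) auto
  then show ?thesis by (rule set_lebesgue_integral_eq_integral)
qed

lemma hazard_integrable_on: "0 \<le> a \<Longrightarrow> hazard integrable_on {a..b}"
  unfolding hazard_def
proof (rule bounded_multiple_integrable_on)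
  assume a: "0 \<le> a"
  show "(\<lambda>t. exp (- window t)) \<in> borel_measurable (lebesgue_on {a..b})"
    using a by (intro continuous_imp_measurable_on_sets_lebesgue continuous_intros
        continuous_on_subset[OF continuous_on_window]) auto
qed (use window_nonneg in auto)

lemma hazard_nonneg: "0 \<le> t \<Longrightarrow> 0 \<le> hazard t"
  unfolding hazard_def by (simp add: rate_nonneg)

lemma cum_hazard_diff: "0 \<le> a \<Longrightarrow> a \<le> b \<Longrightarrow> integral {a..b} hazard = cum_hazard b - cum_hazard a"
  unfolding cum_hazard_def
  using Henstock_Kurzweil_Integration.integral_combine[of 0 a b hazard] hazard_integrable_on[of 0 b] by simp

lemma cum_hazard_mono: "0 \<le> a \<Longrightarrow> a \<le> b \<Longrightarrow> cum_hazard a \<le> cum_hazard b"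
  using integral_nonneg[OF hazard_integrable_on[of a b]] cum_hazard_diff[of a b] hazard_nonneg by auto

lemma cum_hazard_nonneg: "0 \<le> t \<Longrightarrow> 0 \<le> cum_hazard t"
  using cum_hazard_mono[of 0 t] by (simp add: cum_hazard_def)

text \<open>
  On an interval where the window increment is nearly constant, the hazard is nearly proportional to
  the rate.
\<close>
lemma cum_hazard_increment_bounds:
  assumes ab: "0 \<le> a" "a \<le> b" and near: "\<And>s. s \<in> {a..b} \<Longrightarrow> \<bar>window s - \<gamma>\<bar> \<le> \<epsilon>"
  shows "exp (- \<gamma> - \<epsilon>) * (cum b - cum a) \<le> cum_hazard b - cum_hazard a"
    and "cum_hazard b - cum_hazard a \<le> exp (- \<gamma> + \<epsilon>) * (cum b - cum a)"
proof -
  have int: "(\<lambda>s. k * \<mu> s) integrable_on {a..b}" for k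
    using integrable_on_cmult_left[OF rate_integrable_on[OF ab(1)], of k] by simp
  have eq: "integral {a..b} (\<lambda>s. k * \<mu> s) = k * (cum b - cum a)" for k
    using cum_diff[OF ab] by simp
  have "exp (- \<gamma> - \<epsilon>) * \<mu> s \<le> hazard s" "hazard s \<le> exp (- \<gamma> + \<epsilon>) * \<mu> s" if "s \<in> {a..b}" for s
    unfolding hazard_def using near[OF that] that ab rate_nonneg[of s]
    by (auto intro!: mult_right_mono)
  then have "integral {a..b} (\<lambda>s. exp (- \<gamma> - \<epsilon>) * \<mu> s) \<le> integral {a..b} hazard"
    "integral {a..b} hazard \<le> integral {a..b} (\<lambda>s. exp (- \<gamma> + \<epsilon>) * \<mu> s)"
    using int hazard_integrable_on[OF ab(1)] by (intro integral_le; blast)+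
  then show "exp (- \<gamma> - \<epsilon>) * (cum b - cum a) \<le> cum_hazard b - cum_hazard a"
    "cum_hazard b - cum_hazard a \<le> exp (- \<gamma> + \<epsilon>) * (cum b - cum a)"
    unfolding eq cum_hazard_diff[OF ab] by auto
qed

lemma local_closeness:
  assumes "0 \<le> x" "0 < \<epsilon>" "0 < \<eta>"
  obtains d where "0 < d" "d \<le> l"
    "\<And>s. 0 \<le> s \<Longrightarrow> \<bar>s - x\<bar> < d \<Longrightarrow> \<bar>window s - window x\<bar> \<le> \<epsilon>"
    "\<And>a b. 0 \<le> a \<Longrightarrow> a \<le> x \<Longrightarrow> x \<le> b \<Longrightarrow> b - a < d \<Longrightarrow> cum b - cum a < \<eta>"
proof -
  obtain d1 where d1: "0 < d1" "\<And>s. 0 \<le> s \<Longrightarrow> \<bar>s - x\<bar> < d1 \<Longrightarrow> \<bar>window s - window x\<bar> < \<epsilon>"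
    using continuous_on_window assms unfolding continuous_on_iff dist_real_def by fastforce
  obtain d2 where d2: "0 < d2" "\<And>s. 0 \<le> s \<Longrightarrow> \<bar>s - x\<bar> < d2 \<Longrightarrow> \<bar>cum s - cum x\<bar> < \<eta> / 2"
    using continuous_on_cum assms unfolding continuous_on_iff dist_real_def
    by (metis atLeast_iff half_gt_zero)
  show ?thesis
  proof (rule that[of "min l (min d1 d2)"])
    fix a b assume ab: "0 \<le> a" "a \<le> x" "x \<le> b" "b - a < min l (min d1 d2)"
    then have "\<bar>cum a - cum x\<bar> < \<eta> / 2" "\<bar>cum b - cum x\<bar> < \<eta> / 2"
      by (intro d2(2); linarith)+
    then show "cum b - cum a < \<eta>" by linarith
  qed (use d1 d2 l_pos in \<open>auto intro: less_imp_le\<close>)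
qed

text \<open>
  On short intervals the assumption is the desired estimate up to a factor \<open>exp (- 3 * \<epsilon>)\<close>: one
  factor \<open>exp (- \<epsilon>)\<close> is lost by \<open>1 - exp (- z) \<ge> z * exp (- z)\<close>, and two because the window increment
  varies by \<open>\<epsilon>\<close> around its value at a fixed point. As the estimate is additive over adjacent
  intervals, bisection makes it global, and then \<open>\<epsilon>\<close> can tend to 0.
\<close>
lemma ln_decay_ge:
  assumes pos: "\<And>t. 0 \<le> t \<Longrightarrow> 0 < u t"
    and dec: "\<And>a b. 0 \<le> a \<Longrightarrow> a < b \<Longrightarrow>
      u a * (1 - exp (- (cum b - cum a))) * exp (- window b) \<le> u a - u b"
    and st: "0 \<le> s" "s \<le> t"
  shows "cum_hazard t - cum_hazard s \<le> ln (u s) - ln (u t)"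
proof -
  have approx: "exp (- 3 * \<epsilon>) * (cum_hazard t - cum_hazard s) \<le> ln (u s) - ln (u t)"
    if \<epsilon>: "0 < \<epsilon>" for \<epsilon>
  proof -
    have "0 \<le> s \<longrightarrow> exp (- 3 * \<epsilon>) * (cum_hazard t - cum_hazard s) \<le> ln (u s) - ln (u t)"
      using st(2)
    proof (induction rule: Bolzano)
      case (trans a b c)
      then show ?case by (auto simp: algebra_simps)
    next
      case (local x)
      then have x: "0 \<le> x" using st by simp
      obtain d where d: "0 < d" "d \<le> l"
        "\<And>s. 0 \<le> s \<Longrightarrow> \<bar>s - x\<bar> < d \<Longrightarrow> \<bar>window s - window x\<bar> \<le> \<epsilon>"
        "\<And>a b. 0 \<le> a \<Longrightarrow> a \<le> x \<Longrightarrow> x \<le> b \<Longrightarrow> b - a < d \<Longrightarrow> cum b - cum a < \<epsilon>"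
        using local_closeness[OF x \<epsilon> \<epsilon>] by metis
      have "exp (- 3 * \<epsilon>) * (cum_hazard b - cum_hazard a) \<le> ln (u a) - ln (u b)"
        if a: "0 \<le> a" and ab: "a \<le> x" "x \<le> b" "b - a < d" for a b
      proof (cases "a = b")
        case False
        then have lt: "a < b" using ab by simp
        define z where "z = cum b - cum a"
        have z: "0 \<le> z" "z \<le> \<epsilon>" using cum_mono[of a b] d(4)[of a b] a ab by (auto simp: z_def)
        have near: "\<bar>window s - window x\<bar> \<le> \<epsilon>" if "s \<in> {a..b}" for s
          using d(3)[of s] that a ab by auto
        have "z * exp (- z) \<le> 1 - exp (- z)"
        proof -
          have "(1 + z) * exp (- z) \<le> exp z * exp (- z)" by (intro mult_right_mono) auto
          then show ?thesis by (simp add: exp_minus algebra_simps)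
        qed
        moreover have "z * exp (- \<epsilon>) \<le> z * exp (- z)" using z by (intro mult_left_mono) auto
        ultimately have 1: "z * exp (- \<epsilon>) \<le> 1 - exp (- z)" by simp
        have 2: "exp (- window x - \<epsilon>) \<le> exp (- window b)" using near[of b] lt by auto
        have "cum_hazard b - cum_hazard a \<le> exp (- window x + \<epsilon>) * z"
          unfolding z_def by (rule cum_hazard_increment_bounds(2)) (use a lt near in auto)
        then have "exp (- 3 * \<epsilon>) * (cum_hazard b - cum_hazard a)
            \<le> exp (- 3 * \<epsilon>) * (exp (- window x + \<epsilon>) * z)" by simp
        also have "\<dots> = (z * exp (- \<epsilon>)) * exp (- window x - \<epsilon>)"
          by (simp add: algebra_simps flip: exp_add)
        also have "\<dots> \<le> (1 - exp (- z)) * exp (- window b)"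
          using 1 2 z by (intro mult_mono) auto
        also have "\<dots> \<le> 1 - u b / u a"
          using dec[OF a lt] pos[OF a] by (simp add: z_def field_simps)
        also have "\<dots> \<le> ln (u a) - ln (u b)"
          using ln_le_minus_one[of "u b / u a"] pos[of a] pos[of b] a lt by (simp add: ln_div)
        finally show ?thesis .
      qed simp
      then show ?case using d(1) by blast
    qed
    then show ?thesis using st by simp
  qed
  have "((\<lambda>\<epsilon>. exp (- 3 * \<epsilon>) * (cum_hazard t - cum_hazard s))
      \<longlongrightarrow> exp (- 3 * 0) * (cum_hazard t - cum_hazard s)) (at_right 0)"
    by (intro tendsto_intros)
  then have "exp (- 3 * 0) * (cum_hazard t - cum_hazard s) \<le> ln (u s) - ln (u t)"
    by (rule tendsto_upperbound) (use approx in \<open>auto simp: eventually_at_filter\<close>)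
  then show ?thesis by simp
qed

text \<open>
  The counterpart of the previous lemma. Here \<open>- ln (1 - w) \<le> w * exp \<epsilon>\<close>, valid for
  \<open>w \<le> 1 - exp (- \<epsilon>)\<close>, costs one factor \<open>exp \<epsilon>\<close>; the other three come from the
  variation of the window increment and from the truncated window \<open>(b, a + l)\<close>. The factor \<open>K\<close> stands
  for the ratio of survival at times \<open>a - l\<close> and \<open>a\<close>.
\<close>
lemma ln_decay_le:
  assumes pos: "\<And>t. 0 \<le> t \<Longrightarrow> 0 < u t" and T: "0 \<le> T" and K: "1 \<le> K" and \<epsilon>: "0 < \<epsilon>"
    and dec: "\<And>a b. T \<le> a \<Longrightarrow> a < b \<Longrightarrow> b < a + l \<Longrightarrow>
      u a - u b \<le> K * u a * (1 - exp (- (cum b - cum a))) * exp (- (cum (a + l) - cum b))"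
    and st: "T \<le> s" "s \<le> t"
  shows "ln (u s) - ln (u t) \<le> K * exp (4 * \<epsilon>) * (cum_hazard t - cum_hazard s)"
proof -
  have "T \<le> s \<longrightarrow> ln (u s) - ln (u t) \<le> K * exp (4 * \<epsilon>) * (cum_hazard t - cum_hazard s)"
    using st(2)
  proof (induction rule: Bolzano)
    case (trans a b c)
    then show ?case by (auto simp: algebra_simps)
  next
    case (local x)
    then have x: "0 \<le> x" using st T by simp
    \<comment> \<open>The second bound ensures \<open>w \<le> 1 - exp (- \<epsilon>)\<close> for the relative decrease \<open>w\<close> below.\<close>
    define \<eta> where "\<eta> = min \<epsilon> ((1 - exp (- \<epsilon>)) / K)"
    have \<eta>: "0 < \<eta>" using \<epsilon> K by (simp add: \<eta>_def)
    obtain d where d: "0 < d" "d \<le> l"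
      "\<And>s. 0 \<le> s \<Longrightarrow> \<bar>s - x\<bar> < d \<Longrightarrow> \<bar>window s - window x\<bar> \<le> \<epsilon>"
      "\<And>a b. 0 \<le> a \<Longrightarrow> a \<le> x \<Longrightarrow> x \<le> b \<Longrightarrow> b - a < d \<Longrightarrow> cum b - cum a < \<eta>"
      using local_closeness[OF x \<epsilon> \<eta>] by metis
    have "ln (u a) - ln (u b) \<le> K * exp (4 * \<epsilon>) * (cum_hazard b - cum_hazard a)"
      if aT: "T \<le> a" and ab: "a \<le> x" "x \<le> b" "b - a < d" for a b
    proof (cases "a = b")
      case False
      have a: "0 \<le> a" using aT T by simp
      have lt: "a < b" using ab False by simp
      define z where "z = cum b - cum a"
      have z: "0 \<le> z" "z \<le> \<epsilon>" "K * z \<le> 1 - exp (- \<epsilon>)"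
        using cum_mono[of a b] d(4)[of a b] a ab K
        by (auto simp: z_def \<eta>_def pos_less_divide_eq mult.commute)
      have near: "\<bar>window s - window x\<bar> \<le> \<epsilon>" if "s \<in> {a..b}" for s
        using d(3)[of s] that a ab by auto
      define g where "g = cum (a + l) - cum b"
      have g: "g = window a - z" by (simp add: g_def z_def window_def)
      have g0: "0 \<le> g" unfolding g_def using cum_mono[of b "a + l"] a lt ab d by auto
      define w where "w = K * z * exp (- g)"
      have w0: "0 \<le> w" using K z by (simp add: w_def)
      have "w \<le> K * z * 1" unfolding w_def using K z g0 by (intro mult_left_mono) auto
      then have w1: "exp (- \<epsilon>) \<le> 1 - w" using z by simp
      have "u a - u b \<le> K * u a * (1 - exp (- z)) * exp (- g)"
        unfolding z_def g_def using dec[of a b] aT lt ab d by auto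
      also have "\<dots> \<le> K * u a * z * exp (- g)"
        using K pos[OF a] exp_ge_add_one_self[of "- z"]
        by (intro mult_right_mono mult_left_mono) auto
      also have "\<dots> = u a * w" by (simp add: w_def)
      finally have ratio: "u a * (1 - w) \<le> u b" by (simp add: algebra_simps)
      have pw: "0 < 1 - w" using w1 exp_gt_zero[of "- \<epsilon>"] by linarith
      have "ln (u a) - ln (u b) \<le> - ln (1 - w)"
      proof -
        have "ln (u a * (1 - w)) \<le> ln (u b)"
          using ratio pw pos[of a] pos[of b] a lt by (subst ln_le_cancel_iff) auto
        then show ?thesis using pw pos[OF a] by (simp add: ln_mult)
      qed
      also have "\<dots> \<le> 1 / (1 - w) - 1"
        using ln_le_minus_one[of "1 / (1 - w)"] pw by (simp add: ln_div)
      also have "\<dots> = w * (1 / (1 - w))" using pw by (simp add: field_simps)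
      also have "\<dots> \<le> w * exp \<epsilon>"
      proof (rule mult_left_mono)
        have "1 = exp \<epsilon> * exp (- \<epsilon>)" by (simp add: exp_minus)
        also have "\<dots> \<le> exp \<epsilon> * (1 - w)" using w1 by (intro mult_left_mono) auto
        finally show "1 / (1 - w) \<le> exp \<epsilon>" using pw by (simp add: divide_le_eq)
      qed (rule w0)
      also have "\<dots> \<le> K * z * exp (- window x + 2 * \<epsilon>) * exp \<epsilon>"
        unfolding w_def g using near[of a] z lt K by (intro mult_left_mono mult_right_mono) auto
      also have "\<dots> = K * exp (4 * \<epsilon>) * (exp (- window x - \<epsilon>) * z)"
      proof -
        have "exp (- window x + 2 * \<epsilon>) * exp \<epsilon> = exp (4 * \<epsilon>) * exp (- window x - \<epsilon>)"
          by (simp add: exp_add[symmetric])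
        then show ?thesis by (simp add: mult.assoc mult.left_commute)
      qed
      also have "\<dots> \<le> K * exp (4 * \<epsilon>) * (cum_hazard b - cum_hazard a)"
        unfolding z_def using K a lt near
        by (intro mult_left_mono cum_hazard_increment_bounds(1)) auto
      finally show ?thesis .
    qed simp
    then show ?case using d(1) by blast
  qed
  then show ?thesis using st by simp
qed

text \<open>
  The hazard with the window increment replaced by \<open>l * \<mu> t\<close>; this is the integrand of \<open>f\<close>.
\<close>
definition local_hazard :: "real \<Rightarrow> real" where
  "local_hazard t = exp (- l * \<mu> t) * \<mu> t"

lemma local_hazard_integrable_on: "0 \<le> a \<Longrightarrow> local_hazard integrable_on {a..b}"
  unfolding local_hazard_def
proof (rule bounded_multiple_integrable_on)
  assume a: "0 \<le> a"
  have [measurable]: "\<mu> \<in> borel_measurable (lebesgue_on {a..b})"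
    using rate_integrable_on[OF a] by (rule integrable_imp_measurable)
  show "(\<lambda>t. exp (- l * \<mu> t)) \<in> borel_measurable (lebesgue_on {a..b})" by measurable
qed (use rate_nonneg l_pos in auto)

lemma local_hazard_nonneg: "0 \<le> t \<Longrightarrow> 0 \<le> local_hazard t"
  unfolding local_hazard_def by (simp add: rate_nonneg)

lemma cum_local_hazard_ratio:
  assumes lim: "((\<lambda>t. window t - l * \<mu> t) \<longlongrightarrow> 0) at_top"
    and div: "filterlim cum_hazard at_top at_top" and c: "0 \<le> c"
  shows "((\<lambda>t. integral {c..t} local_hazard / cum_hazard t) \<longlongrightarrow> 1) at_top"
proof (rule ratio_tendsto_1[OF div])
  fix \<epsilon> :: real assume \<epsilon>: "0 < \<epsilon>"
  have "\<forall>\<^sub>F t in at_top. \<bar>window t - l * \<mu> t\<bar> < ln (1 + \<epsilon>)"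
    using tendstoD[OF lim, of "ln (1 + \<epsilon>)"] \<epsilon> by (simp add: dist_real_def)
  then obtain T0 where T0: "\<And>t. T0 \<le> t \<Longrightarrow> \<bar>window t - l * \<mu> t\<bar> < ln (1 + \<epsilon>)"
    unfolding eventually_at_top_linorder by blast
  define T where "T = max 0 T0"
  have bound: "hazard t \<le> (1 + \<epsilon>) * local_hazard t" "local_hazard t \<le> (1 + \<epsilon>) * hazard t"
    if "T \<le> t" for t
  proof -
    have T: "\<bar>window t - l * \<mu> t\<bar> < ln (1 + \<epsilon>)" "0 \<le> \<mu> t"
      using T0 that rate_nonneg by (auto simp: T_def)
    have "exp (- window t) \<le> exp (ln (1 + \<epsilon>) + - l * \<mu> t)"
      "exp (- l * \<mu> t) \<le> exp (ln (1 + \<epsilon>) + - window t)"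
      using T(1) by auto
    then have "exp (- window t) \<le> (1 + \<epsilon>) * exp (- l * \<mu> t)"
      "exp (- l * \<mu> t) \<le> (1 + \<epsilon>) * exp (- window t)"
      using \<epsilon> by (simp_all only: exp_add) simp_all
    from this[THEN mult_right_mono, OF T(2)] show "hazard t \<le> (1 + \<epsilon>) * local_hazard t"
      "local_hazard t \<le> (1 + \<epsilon>) * hazard t"
      by (simp_all add: hazard_def local_hazard_def mult.assoc)
  qed
  show "\<exists>C. \<forall>\<^sub>F t in at_top. integral {c..t} local_hazard \<le> C + (1 + \<epsilon>) * cum_hazard t"
    unfolding cum_hazard_def
    using c by (intro integral_tail_compare[of _ _ _ _ T] local_hazard_integrable_on hazard_integrable_on bound) auto
  show "\<exists>C. \<forall>\<^sub>F t in at_top. cum_hazard t \<le> C + (1 + \<epsilon>) * integral {c..t} local_hazard"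
    unfolding cum_hazard_def
    using c by (intro integral_tail_compare[of _ _ _ _ T] local_hazard_integrable_on hazard_integrable_on bound) auto
qed

lemma cum_hazard_at_top:
  assumes inf: "(\<integral>\<^sup>+t\<in>{0<..}. ennreal (hazard t) \<partial>lebesgue) = \<infinity>"
  shows "filterlim cum_hazard at_top at_top"
proof (rule ccontr)
  assume "\<not> ?thesis"
  then obtain B where B: "\<not> (\<forall>\<^sub>F t in at_top. B \<le> cum_hazard t)"
    unfolding filterlim_at_top by blast
  have le: "cum_hazard t \<le> B" if "0 \<le> t" for t
  proof (rule ccontr)
    assume "\<not> cum_hazard t \<le> B"
    then have "\<forall>s\<ge>t. B \<le> cum_hazard s" using cum_hazard_mono[OF that] by force
    then show False using B by (auto simp: eventually_at_top_linorder)
  qed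
  let ?f = "\<lambda>n x. ennreal (hazard x) * indicator {0..real n} x"
  have int: "integral\<^sup>N lebesgue (?f n) = ennreal (cum_hazard (real n))" for n
  proof -
    have "(hazard has_integral cum_hazard (real n)) {0..real n}"
      unfolding cum_hazard_def by (rule integrable_integral) (rule hazard_integrable_on, simp)
    then have "integral\<^sup>N lborel (?f n) = ennreal (cum_hazard (real n))"
      by (intro nn_integral_has_integral_lebesgue') (auto intro: hazard_nonneg)
    then show ?thesis by (simp add: nn_integral_completion)
  qed
  have meas: "?f n \<in> borel_measurable lebesgue" for n
  proof -
    have "(\<lambda>x. indicator {0..real n} x *\<^sub>R hazard x) \<in> borel_measurable lebesgue"
      using hazard_integrable_on[of 0 "real n"]
      by (intro has_integral_implies_lebesgue_measurable[OF integrable_integral]) auto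
    then have "(\<lambda>x. ennreal (indicator {0..real n} x *\<^sub>R hazard x)) \<in> borel_measurable lebesgue"
      by measurable
    also have "(\<lambda>x. ennreal (indicator {0..real n} x *\<^sub>R hazard x)) = ?f n"
      by (auto simp: indicator_def)
    finally show ?thesis .
  qed
  have "(\<integral>\<^sup>+t\<in>{0<..}. ennreal (hazard t) \<partial>lebesgue) \<le> integral\<^sup>N lebesgue (\<lambda>x. SUP n. ?f n x)"
  proof (rule nn_integral_mono)
    fix x :: real
    show "ennreal (hazard x) * indicator {0<..} x \<le> (SUP n. ?f n x)"
    proof (cases "0 < x")
      case True
      obtain n where "x \<le> real n" using real_arch_simple by blast
      then have "ennreal (hazard x) * indicator {0<..} x \<le> ?f n x" using True by simp
      then show ?thesis by (rule SUP_upper2[rotated]) simp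
    qed simp
  qed
  also have "\<dots> = (SUP n. integral\<^sup>N lebesgue (?f n))"
    by (intro nn_integral_monotone_convergence_SUP meas)
      (auto simp: incseq_def le_fun_def split: split_indicator)
  also have "\<dots> \<le> ennreal B"
    unfolding int by (intro SUP_least ennreal_leI le) simp
  finally show False using inf by (simp add: top_unique)
qed

lemma cum_increment_ge:
  assumes "0 \<le> a" "a \<le> b" "\<And>s. s \<in> {a..b} \<Longrightarrow> R \<le> \<mu> s"
  shows "R * (b - a) \<le> cum b - cum a"
proof -
  have "integral {a..b} (\<lambda>s. R) \<le> integral {a..b} \<mu>"
    using assms by (intro integral_le rate_integrable_on) auto
  then show ?thesis using cum_diff[OF assms(1,2)] assms(2) by (simp add: mult.commute)
qed

lemma set_nn_integral_rate:
  assumes ab: "0 \<le> a" "a \<le> b" and J: "{a<..<b} \<subseteq> J" "J \<subseteq> {a..b}"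
  shows "(\<integral>\<^sup>+t\<in>J. ennreal (\<mu> t) \<partial>lebesgue) = ennreal (cum b - cum a)"
proof -
  have "(\<mu> has_integral (cum b - cum a)) {a..b}"
    using integrable_integral[OF rate_integrable_on[OF ab(1)]] cum_diff[OF ab] by metis
  moreover have "negligible {x \<in> {a..b} - J. \<mu> x \<noteq> 0}" "negligible {x \<in> J - {a..b}. \<mu> x \<noteq> 0}"
    by (rule negligible_subset[of "{a, b}"]; use J in force)+
  ultimately have "(\<mu> has_integral (cum b - cum a)) J"
    using has_integral_spike_set_eq by blast
  then have "integral\<^sup>N lborel (\<lambda>x. ennreal (\<mu> x) * indicator J x) = ennreal (cum b - cum a)"
    using J ab by (intro nn_integral_has_integral_lebesgue') (auto intro!: rate_nonneg)
  then show ?thesis by (simp add: nn_integral_completion)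
qed

end

text \<open>
  The assumptions on \<open>u\<close> are the inequalities satisfied by the probability of survival. The lower bound
  on \<open>- ln (u t)\<close> is immediate. For the upper bound, two half steps show that \<open>u (a - l) \<le> K * u a\<close> for
  large \<open>a\<close>.
\<close>
lemma (in windowed_rate) ln_survival_asymptotics:
  assumes pos: "\<And>t. 0 \<le> t \<Longrightarrow> 0 < u t"
    and dec_ge: "\<And>a b. 0 \<le> a \<Longrightarrow> a < b \<Longrightarrow>
      u a * (1 - exp (- (cum b - cum a))) * exp (- window b) \<le> u a - u b"
    and dec_le: "\<And>a b. l \<le> a \<Longrightarrow> a < b \<Longrightarrow> b < a + l \<Longrightarrow>
      u a - u b \<le> u (a - l) * (1 - exp (- (cum b - cum a))) * exp (- (cum (a + l) - cum b))"
    and step: "\<And>a. 0 \<le> a \<Longrightarrow>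
      u a * (1 - exp (- (cum (a + l) - cum (a + l / 2)))) \<le> u (a + l / 2)"
    and rate: "filterlim \<mu> at_top at_top" and div: "filterlim cum_hazard at_top at_top"
  shows "((\<lambda>t. - ln (u t) / cum_hazard t) \<longlongrightarrow> 1) at_top"
proof (rule ratio_tendsto_1[OF div])
  fix \<epsilon> :: real assume \<epsilon>: "0 < \<epsilon>"
  \<comment> \<open>Chosen such that the total loss \<open>K * exp (4 * \<delta>)\<close> with \<open>K = exp \<delta>\<close> is \<open>1 + \<epsilon>\<close>.\<close>
  define \<delta> where "\<delta> = ln (1 + \<epsilon>) / 5"
  define K where "K = exp \<delta>"
  have \<delta>: "0 < \<delta>" using \<epsilon> by (simp add: \<delta>_def)
  have K: "1 \<le> K" "K * exp (4 * \<delta>) = 1 + \<epsilon>"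
  proof -
    have "K * exp (4 * \<delta>) = exp (5 * \<delta>)" unfolding K_def exp_add[symmetric] by simp
    then show "K * exp (4 * \<delta>) = 1 + \<epsilon>" using \<epsilon> by (simp add: \<delta>_def)
    show "1 \<le> K" using \<delta> by (simp add: K_def)
  qed
  \<comment> \<open>Where the rate exceeds \<open>R\<close>, a half window is void with probability at most \<open>1 - exp (- \<delta> / 2)\<close>.\<close>
  define R where "R = - 2 / l * ln (1 - exp (- \<delta> / 2))"
  have R: "exp (- (R * (l / 2))) = 1 - exp (- \<delta> / 2)"
  proof -
    have "- (R * (l / 2)) = ln (1 - exp (- \<delta> / 2))" using l_pos by (simp add: R_def)
    then show ?thesis using \<delta> by simp
  qed
  obtain T0 where T0: "\<And>t. T0 \<le> t \<Longrightarrow> R \<le> \<mu> t"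
    using rate unfolding filterlim_at_top eventually_at_top_linorder by blast
  define T where "T = max 0 T0 + l"
  have T: "l \<le> T" "0 \<le> T" using l_pos by (auto simp: T_def)
  have half: "u a * exp (- \<delta> / 2) \<le> u (a + l / 2)" if "max 0 T0 \<le> a" for a
  proof -
    have "R * (l / 2) \<le> cum (a + l) - cum (a + l / 2)"
      using cum_increment_ge[of "a + l / 2" "a + l" R] that T0 l_pos by auto
    then have "exp (- (cum (a + l) - cum (a + l / 2))) \<le> 1 - exp (- \<delta> / 2)"
      unfolding R[symmetric] by simp
    then have "u a * exp (- \<delta> / 2) \<le> u a * (1 - exp (- (cum (a + l) - cum (a + l / 2))))"
      using pos[of a] that by (intro mult_left_mono) auto
    also have "\<dots> \<le> u (a + l / 2)" using step that by simp
    finally show ?thesis .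
  qed
  have lag: "u (a - l) \<le> K * u a" if "T \<le> a" for a
  proof -
    have a: "max 0 T0 \<le> a - l" using that unfolding T_def by linarith
    have "u (a - l) * exp (- \<delta>) = u (a - l) * exp (- \<delta> / 2) * exp (- \<delta> / 2)"
      unfolding mult.assoc exp_add[symmetric] by simp
    also have "\<dots> \<le> u (a - l / 2) * exp (- \<delta> / 2)"
      using half[OF a] by (intro mult_right_mono) auto
    also have "\<dots> \<le> u a" using half[of "a - l / 2"] a l_pos by auto
    finally have "K * (u (a - l) * exp (- \<delta>)) \<le> K * u a" using K by (intro mult_left_mono) auto
    then show ?thesis by (simp add: K_def exp_minus field_simps)
  qed
  show "\<exists>C. \<forall>\<^sub>F t in at_top. - ln (u t) \<le> C + (1 + \<epsilon>) * cum_hazard t"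
  proof (intro exI, unfold eventually_at_top_linorder, intro exI allI impI)
    fix t assume t: "T \<le> t"
    have "ln (u T) - ln (u t) \<le> K * exp (4 * \<delta>) * (cum_hazard t - cum_hazard T)"
    proof (rule ln_decay_le[OF pos T(2) K(1) \<delta> _ order_refl t])
      fix a b assume ab: "T \<le> a" "a < b" "b < a + l"
      have "u a - u b \<le> u (a - l) * (1 - exp (- (cum b - cum a))) * exp (- (cum (a + l) - cum b))"
        using dec_le ab T by simp
      also have "\<dots> \<le> K * u a * (1 - exp (- (cum b - cum a))) * exp (- (cum (a + l) - cum b))"
        using lag[OF ab(1)] cum_mono[of a b] ab T by (intro mult_right_mono) auto
      finally show "u a - u b \<le> K * u a * (1 - exp (- (cum b - cum a))) * exp (- (cum (a + l) - cum b))" .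
    qed
    then have "- ln (u t) \<le> - ln (u T) + (1 + \<epsilon>) * cum_hazard t - (1 + \<epsilon>) * cum_hazard T"
      unfolding K(2) by (simp add: right_diff_distrib)
    moreover have "0 \<le> (1 + \<epsilon>) * cum_hazard T" using \<epsilon> cum_hazard_nonneg[OF T(2)] by simp
    ultimately show "- ln (u t) \<le> - ln (u T) + (1 + \<epsilon>) * cum_hazard t" by linarith
  qed
  show "\<exists>C. \<forall>\<^sub>F t in at_top. cum_hazard t \<le> C + (1 + \<epsilon>) * - ln (u t)"
  proof (intro exI, unfold eventually_at_top_linorder, intro exI allI impI)
    fix t :: real assume t: "0 \<le> t"
    have "cum_hazard t - cum_hazard 0 \<le> ln (u 0) - ln (u t)"
      by (rule ln_decay_ge[OF pos dec_ge]) (use t in auto)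
    then have 1: "cum_hazard t \<le> ln (u 0) - ln (u t)" by (simp add: cum_hazard_def)
    then have "0 \<le> ln (u 0) - ln (u t)" using cum_hazard_nonneg[OF t] by linarith
    then have "0 \<le> \<epsilon> * (ln (u 0) - ln (u t))" using \<epsilon> by simp
    then show "cum_hazard t \<le> (1 + \<epsilon>) * ln (u 0) + (1 + \<epsilon>) * - ln (u t)"
      using 1 by (simp add: algebra_simps)
  qed
qed

section \<open>The Poisson process with a given rate\<close>

lemma rate_function_windowed_rate:
  assumes "rate_function \<mu>" "0 < l"
  shows "windowed_rate \<mu> l"
proof
  show "0 < l" by fact
  show "0 \<le> \<mu> t" if "0 \<le> t" for t using assms that by (simp add: rate_function_def)
  fix t :: real
  let ?g = "\<lambda>x. indicator {0<..<t} x * \<mu> x"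
  have "(\<lambda>x. indicator {0..} x *\<^sub>R \<mu> x) \<in> borel_measurable lebesgue"
    using assms(1) by (simp add: rate_function_def set_borel_measurable_def)
  then have "(\<lambda>x. indicator {0<..<t} x * (indicator {0..} x *\<^sub>R \<mu> x)) \<in> borel_measurable lebesgue"
    by (intro borel_measurable_times borel_measurable_indicator) auto
  also have "(\<lambda>x. indicator {0<..<t} x * (indicator {0..} x *\<^sub>R \<mu> x)) = ?g"
    by (auto simp: indicator_def)
  finally have meas: "?g \<in> borel_measurable lebesgue" .
  have nonneg: "0 \<le> ?g x" for x
    using assms(1) by (auto simp: rate_function_def indicator_def)
  have "integral\<^sup>N lebesgue ?g = cumulative_rate \<mu> 0 t"
    unfolding cumulative_rate_def by (intro nn_integral_cong) (auto simp: indicator_def)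
  also have "\<dots> < \<infinity>" using assms(1) by (simp add: rate_function_def)
  finally obtain r where "0 \<le> r" "integral\<^sup>N lebesgue ?g = ennreal r"
    by (cases "integral\<^sup>N lebesgue ?g" rule: ennreal_cases) auto
  then have "(?g has_integral r) UNIV"
    using meas nonneg has_integral_iff_nn_integral_lebesgue[of ?g r] by auto
  also have "?g = (\<lambda>x. if x \<in> {0<..<t} then \<mu> x else 0)" by (auto simp: indicator_def)
  finally have "(\<mu> has_integral r) {0<..<t}" by (simp only: has_integral_restrict_UNIV)
  then show "\<mu> integrable_on {0..t}"
    unfolding integrable_on_Icc_iff_Ioo by (rule has_integral_integrable)
qed

context windowed_rate
begin

lemma cumulative_rate_eq:
  assumes "0 \<le> a" "a \<le> b"
  shows "cumulative_rate \<mu> a b = ennreal (cum b - cum a)"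
proof -
  have eq: "{t. a < t \<and> ereal t < ereal b} = {a<..<b}" by auto
  have "{a<..<b} \<subseteq> {a..b}" by (simp add: subset_eq)
  then show ?thesis
    unfolding cumulative_rate_def eq by (rule set_nn_integral_rate[OF assms order_refl])
qed

lemma emeasure_intensity:
  assumes rf: "rate_function \<mu>" and J: "J \<in> sets borel" 
  shows "emeasure (intensity_measure \<mu>) J = (\<integral>\<^sup>+t\<in>J \<inter> {0<..}. ennreal (\<mu> t) \<partial>lebesgue)"
proof -
  have "(\<lambda>x. indicator {0..} x *\<^sub>R \<mu> x) \<in> borel_measurable lebesgue"
    using rf by (simp add: rate_function_def set_borel_measurable_def)
  then have "(\<lambda>x. ennreal (indicator {0..} x *\<^sub>R \<mu> x) * indicator {0<..} x) \<in> borel_measurable lebesgue"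
    by (intro borel_measurable_times_ennreal borel_measurable_indicator) auto
  also have "(\<lambda>x. ennreal (indicator {0..} x *\<^sub>R \<mu> x) * indicator {0<..} x) =
      (\<lambda>x. ennreal (\<mu> x) * indicator {0<..} x)"
    by (auto simp: indicator_def)
  finally have "emeasure (intensity_measure \<mu>) J =
      (\<integral>\<^sup>+t\<in>J. (ennreal (\<mu> t) * indicator {0<..} t) \<partial>lebesgue)"
    unfolding intensity_measure_def by (rule emeasure_density) (use J in auto)
  also have "\<dots> = (\<integral>\<^sup>+t\<in>J \<inter> {0<..}. ennreal (\<mu> t) \<partial>lebesgue)"
    by (intro nn_integral_cong) (auto simp: indicator_def)
  finally show ?thesis .
qed

lemma measure_intensity:
  assumes rf: "rate_function \<mu>" and J: "J \<in> sets borel" 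
    and ab: "0 \<le> a" "a \<le> b" and sub: "{a<..<b} \<subseteq> J" "J \<subseteq> {a<..b}"
  shows "measure (intensity_measure \<mu>) J = cum b - cum a"
proof -
  have "J \<inter> {0<..} = J" using sub ab by auto
  then have "emeasure (intensity_measure \<mu>) J = ennreal (cum b - cum a)"
    using emeasure_intensity[OF rf J] set_nn_integral_rate[OF ab sub(1)]
      order_trans[OF sub(2), of "{a..b}"] by (simp add: subset_eq)
  then show ?thesis using cum_mono[OF ab] by (simp add: measure_def)
qed

lemma emeasure_intensity_finite:
  assumes rf: "rate_function \<mu>" and J: "J \<in> sets borel" "bounded J"
  shows "emeasure (intensity_measure \<mu>) J \<noteq> \<infinity>"
proof -
  obtain T where T: "\<And>x. x \<in> J \<Longrightarrow> \<bar>x\<bar> \<le> T" using J(2) unfolding bounded_iff by auto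
  let ?T = "max 0 T"
  have sub: "J \<inter> {0<..} \<subseteq> {0..?T}" using T by fastforce
  have "emeasure (intensity_measure \<mu>) J = (\<integral>\<^sup>+t\<in>J \<inter> {0<..}. ennreal (\<mu> t) \<partial>lebesgue)"
    by (rule emeasure_intensity[OF rf J(1)])
  also have "\<dots> \<le> (\<integral>\<^sup>+t\<in>{0..?T}. ennreal (\<mu> t) \<partial>lebesgue)"
    using sub by (intro nn_integral_mono) (auto split: split_indicator)
  also have "\<dots> = ennreal (cum ?T - cum 0)"
    by (rule set_nn_integral_rate) auto
  finally show ?thesis by (auto simp: top_unique)
qed

lemma poisson_void_process:
  assumes rf: "rate_function \<mu>" and pp: "poisson_process P (intensity_measure \<mu>) N"
  shows "void_process P N (intensity_measure \<mu>)"
proof -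
  have cfgs: "\<forall>\<omega>\<in>space P. N \<omega> \<subseteq> {0<..} \<and> (\<forall>t. finite (N \<omega> \<inter> {..t}))"
    using pp unfolding poisson_process_def by (elim conjE)
  have counts: "\<forall>B\<in>sets borel. bounded B \<longrightarrow>
      (\<lambda>\<omega>. card (N \<omega> \<inter> B)) \<in> measurable P (count_space UNIV) \<and>
      (\<forall>k. measure P {\<omega>\<in>space P. card (N \<omega> \<inter> B) = k} =
        measure (intensity_measure \<mu>) B ^ k / fact k * exp (- measure (intensity_measure \<mu>) B))"
    using pp unfolding poisson_process_def by (elim conjE)
  have cfg: "point_configuration (N \<omega>)" if "\<omega> \<in> space P" for \<omega>
    using cfgs that unfolding point_configuration_def by blast
  have card0: "card (N \<omega> \<inter> B) = 0 \<longleftrightarrow> N \<omega> \<inter> B = {}" if \<omega>: "\<omega> \<in> space P" and B: "bounded B" for \<omega> B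
  proof -
    obtain T where "\<And>x. x \<in> B \<Longrightarrow> \<bar>x\<bar> \<le> T" using B unfolding bounded_iff by auto
    then have "N \<omega> \<inter> B \<subseteq> N \<omega> \<inter> {..T}" by fastforce
    then have "finite (N \<omega> \<inter> B)"
      using cfg[OF \<omega>] unfolding point_configuration_def by (blast intro: finite_subset)
    then show ?thesis by simp
  qed
  have void: "{\<omega> \<in> space P. N \<omega> \<inter> B = {}} = {\<omega> \<in> space P. card (N \<omega> \<inter> B) = 0}" if "bounded B" for B
    using card0 that by blast
  interpret prob_space P using pp by (simp add: poisson_process_def)
  show ?thesis
  proof
    fix B :: "real set" assume B: "B \<in> sets borel"
    show "B \<in> sets (intensity_measure \<mu>)" using B by (simp add: intensity_measure_def)
    assume bd: "bounded B"
    show "emeasure (intensity_measure \<mu>) B \<noteq> \<infinity>" by (rule emeasure_intensity_finite[OF rf B bd])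
    have count: "(\<lambda>\<omega>. card (N \<omega> \<inter> B)) \<in> measurable P (count_space UNIV)"
      using counts B bd by blast
    have "measure P {\<omega>\<in>space P. card (N \<omega> \<inter> B) = 0} =
        measure (intensity_measure \<mu>) B ^ 0 / fact 0 * exp (- measure (intensity_measure \<mu>) B)"
      using counts B bd by blast
    then have law: "measure P {\<omega> \<in> space P. card (N \<omega> \<inter> B) = 0} = exp (- measure (intensity_measure \<mu>) B)"
      by simp
    have "(\<lambda>\<omega>. card (N \<omega> \<inter> B)) -` {0} \<inter> space P \<in> events"
      by (rule measurable_sets[OF count]) simp
    also have "(\<lambda>\<omega>. card (N \<omega> \<inter> B)) -` {0} \<inter> space P = {\<omega> \<in> space P. N \<omega> \<inter> B = {}}"
      unfolding void[OF bd] by auto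
    finally show "{\<omega> \<in> space P. N \<omega> \<inter> B = {}} \<in> events" .
    show "prob {\<omega> \<in> space P. N \<omega> \<inter> B = {}} = exp (- measure (intensity_measure \<mu>) B)"
      unfolding void[OF bd] by (rule law)
  qed (rule cfg)
qed

text \<open>
  This is where positivity of the rate almost everywhere enters; it ensures that no window is void
  almost surely, and hence that survival has positive probability.
\<close>
lemma cum_strict_mono:
  assumes rf: "rate_function \<mu>" and ab: "0 \<le> a" "a < b"
  shows "cum a < cum b"
proof (rule ccontr)
  assume "\<not> cum a < cum b"
  then have "cum b - cum a = 0" using cum_mono[of a b] ab by simp
  then have "(\<integral>\<^sup>+t\<in>{a..b}. ennreal (\<mu> t) \<partial>lebesgue) = 0"
    using set_nn_integral_rate[of a b "{a..b}"] ab by (simp add: subset_eq)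
  moreover have "(\<lambda>x. ennreal (\<mu> x) * indicator {a..b} x) \<in> borel_measurable lebesgue"
  proof -
    have "(\<lambda>x. indicator {a..b} x *\<^sub>R \<mu> x) \<in> borel_measurable lebesgue"
      using rate_integrable_on[OF ab(1), of b]
      by (intro has_integral_implies_lebesgue_measurable[OF integrable_integral])
    then have "(\<lambda>x. ennreal (indicator {a..b} x *\<^sub>R \<mu> x)) \<in> borel_measurable lebesgue"
      by measurable
    also have "(\<lambda>x. ennreal (indicator {a..b} x *\<^sub>R \<mu> x)) = (\<lambda>x. ennreal (\<mu> x) * indicator {a..b} x)"
      by (auto simp: indicator_def)
    finally show ?thesis .
  qed
  ultimately have "AE x in lebesgue. ennreal (\<mu> x) * indicator {a..b} x = 0"
    using nn_integral_0_iff_AE by blast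
  moreover have "AE x in lebesgue. 0 \<le> x \<longrightarrow> 0 < \<mu> x" using rf by (simp add: rate_function_def)
  ultimately have "AE x in lebesgue. x \<notin> {a..b}"
    by eventually_elim (use ab in \<open>auto simp: indicator_def split: if_splits\<close>)
  then have "{a..b} \<in> null_sets lebesgue" by (subst AE_iff_null_sets) auto
  then show False using ab by (auto simp: null_sets_def)
qed

end

text \<open>
  A rate that tends to infinity excludes a finite total rate, so the second alternative holds; it is
  the divergence of the integrated hazard.
\<close>
lemma (in windowed_rate) cum_hazard_at_top_of_alternative:
  assumes rf: "rate_function \<mu>" and rate: "filterlim \<mu> at_top at_top"
    and alt: "cumulative_rate \<mu> 0 \<infinity> < \<infinity> \<or>
      (\<integral>\<^sup>+t\<in>{0<..}. ennreal (exp (- enn2real (cumulative_rate \<mu> t (t + l))) * \<mu> t) \<partial>lebesgue) = \<infinity>"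
  shows "filterlim cum_hazard at_top at_top"
proof (rule cum_hazard_at_top)
  obtain T0 where T0: "\<And>t. T0 \<le> t \<Longrightarrow> 1 \<le> \<mu> t"
    using rate unfolding filterlim_at_top eventually_at_top_linorder by blast
  define T where "T = max 0 T0"
  have large: "ennreal x \<le> cumulative_rate \<mu> 0 \<infinity>" if "0 \<le> x" for x
  proof -
    have "1 * ((T + x) - T) \<le> cum (T + x) - cum T"
      by (rule cum_increment_ge) (use that T0 in \<open>auto simp: T_def\<close>)
    also have "\<dots> \<le> cum (T + x) - cum 0"
      using cum_mono[of 0 T] by (simp add: T_def)
    finally have "ennreal x \<le> ennreal (cum (T + x) - cum 0)" by (intro ennreal_leI) simp
    also have "\<dots> = cumulative_rate \<mu> 0 (T + x)"
      using cumulative_rate_eq[of 0 "T + x"] that by (simp add: T_def)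
    also have "\<dots> \<le> cumulative_rate \<mu> 0 \<infinity>"
      unfolding cumulative_rate_def by (intro nn_integral_mono) (auto split: split_indicator)
    finally show ?thesis .
  qed
  have "\<not> cumulative_rate \<mu> 0 \<infinity> < \<infinity>"
  proof
    assume "cumulative_rate \<mu> 0 \<infinity> < \<infinity>"
    then obtain r where r: "0 \<le> r" "cumulative_rate \<mu> 0 \<infinity> = ennreal r"
      by (cases "cumulative_rate \<mu> 0 \<infinity>" rule: ennreal_cases) auto
    show False using large[of "r + 1"] r by simp
  qed
  with alt have inf: "(\<integral>\<^sup>+t\<in>{0<..}. ennreal (exp (- enn2real (cumulative_rate \<mu> t (t + l))) * \<mu> t) \<partial>lebesgue) = \<infinity>"
    by blast
  have "enn2real (cumulative_rate \<mu> t (t + l)) = window t" if "0 < t" for t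
    using that window_nonneg[of t] cumulative_rate_eq[of t "t + l"] l_pos by (simp add: window_def)
  then have "(\<integral>\<^sup>+t\<in>{0<..}. ennreal (hazard t) \<partial>lebesgue) =
      (\<integral>\<^sup>+t\<in>{0<..}. ennreal (exp (- enn2real (cumulative_rate \<mu> t (t + l))) * \<mu> t) \<partial>lebesgue)"
    by (intro nn_integral_cong) (auto simp: hazard_def split: split_indicator)
  then show "(\<integral>\<^sup>+t\<in>{0<..}. ennreal (hazard t) \<partial>lebesgue) = \<infinity>" using inf by simp
qed

lemma (in windowed_rate) interval_integral_local_hazard:
  assumes "0 \<le> c" "c \<le> t"
  shows "interval_lebesgue_integral lebesgue c t (\<lambda>s. exp (- l * \<mu> s) * \<mu> s) =
    integral {c..t} local_hazard"
proof -
  have int: "local_hazard integrable_on {c..t}" using assms by (intro local_hazard_integrable_on)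
  then have "local_hazard absolutely_integrable_on {c..t}"
    using assms by (intro nonnegative_absolutely_integrable_1) (auto intro: local_hazard_nonneg)
  then have "local_hazard absolutely_integrable_on {c<..<t}"
    by (simp add: absolutely_integrable_on_Icc_iff_Ioo)
  then have "(LINT s:{c<..<t}|lebesgue. local_hazard s) = integral {c<..<t} local_hazard"
    by (rule set_lebesgue_integral_eq_integral)
  also have "\<dots> = integral {c..t} local_hazard" by (simp only: integral_open_interval_real)
  finally show ?thesis
    using assms by (simp add: interval_lebesgue_integral_def local_hazard_def)
qed

section \<open>Logarithmic tail asymptotics\<close>

theorem proposition5p3:
  fixes P :: "'w measure" and N :: "'w \<Rightarrow> real set"
    and \<mu> :: "real \<Rightarrow> real" and l c :: real
  assumes "0 < l"
    and "rate_function \<mu>"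
    and "poisson_process P (intensity_measure \<mu>) N"
    and "AE t in lebesgue. 0 \<le> t \<longrightarrow> continuous (at t within {0..}) \<mu>"
    and "filterlim \<mu> at_top at_top"
    and "(\<lambda>t. enn2real (cumulative_rate \<mu> t (t + l)) - l * \<mu> t) \<in> o(\<lambda>_. 1)"
    and "cumulative_rate \<mu> 0 \<infinity> < \<infinity> \<or>
         (\<integral>\<^sup>+t\<in>{0<..}. ennreal (exp (- enn2real (cumulative_rate \<mu> t (t + l))) * \<mu> t) \<partial>lebesgue) = \<infinity>"
    and "0 \<le> c"
  shows "log_asymp
           (\<lambda>t. measure P {\<omega> \<in> space P. ereal t < gap_start l (N \<omega>)})
           (\<lambda>t. exp (- interval_lebesgue_integral lebesgue c t (\<lambda>s. exp (- l * \<mu> s) * \<mu> s)))"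
proof -
  note rf = \<open>rate_function \<mu>\<close> and l = \<open>0 < l\<close>
  interpret windowed_rate \<mu> l using rf l by (rule rate_function_windowed_rate)
  interpret void_process P N "intensity_measure \<mu>"
    using rf \<open>poisson_process P (intensity_measure \<mu>) N\<close> by (rule poisson_void_process)
  define u where "u = survival l"
  have half_open: "measure (intensity_measure \<mu>) {a<..b} = cum b - cum a"
    if "0 \<le> a" "a \<le> b" for a b
    by (rule measure_intensity[OF rf _ that]) (auto simp: subset_eq)
  have opened: "measure (intensity_measure \<mu>) {a<..<b} = cum b - cum a"
    if "0 \<le> a" "a \<le> b" for a b
    by (rule measure_intensity[OF rf _ that]) (auto simp: subset_eq)
  have tail: "measure P {\<omega> \<in> space P. ereal t < gap_start l (N \<omega>)} = u t" for t
    unfolding u_def survival_def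
    by (rule arg_cong[where f = prob])
      (use configuration in \<open>auto simp: less_gap_start_iff_gapless\<close>)
  have step: "u a * (1 - exp (- (cum (a + l) - cum (a + l / 2)))) \<le> u (a + l / 2)"
    if "0 \<le> a" for a
    using survival_half_step[OF that l] opened[of "a + l / 2" "a + l"] that l by (simp add: u_def)
  \<comment> \<open>Survival by any multiple of \<open>l / 2\<close>, hence up to any time, has positive probability.\<close>
  have grid_pos: "0 < u (real n * (l / 2))" for n
  proof (induction n)
    case 0
    have "0 < 1 - exp (- (cum l - cum 0))"
      using cum_strict_mono[OF rf, of 0 l] l by simp
    also have "\<dots> \<le> u 0"
      using survival_zero[OF l] opened[of 0 l] l by (simp add: u_def)
    finally show ?case by simp
  next
    case (Suc n)
    let ?a = "real n * (l / 2)"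
    have a: "0 \<le> ?a" using l by simp
    have "0 < u ?a * (1 - exp (- (cum (?a + l) - cum (?a + l / 2))))"
      using Suc cum_strict_mono[OF rf, of "?a + l / 2" "?a + l"] a l by simp
    also have "\<dots> \<le> u (?a + l / 2)" by (rule step[OF a])
    also have "?a + l / 2 = real (Suc n) * (l / 2)" by (simp add: algebra_simps)
    finally show ?case .
  qed
  have pos: "0 < u t" if "0 \<le> t" for t
  proof -
    obtain n where "t / (l / 2) \<le> real n" using real_arch_simple by blast
    then have "t \<le> real n * (l / 2)" using l by (simp add: field_simps)
    then have "u (real n * (l / 2)) \<le> u t"
      unfolding u_def survival_def
      by (intro finite_measure_mono gapless_event that) (auto intro: gapless_antimono_time)
    then show ?thesis using grid_pos[of n] by linarith
  qed
  have div: "filterlim cum_hazard at_top at_top"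
    using cum_hazard_at_top_of_alternative[OF rf] assms by blast
  have "((\<lambda>t. - ln (u t) / cum_hazard t) \<longlongrightarrow> 1) at_top"
  proof (rule ln_survival_asymptotics[OF pos _ _ step _ div])
    fix a b :: real assume ab: "0 \<le> a" "a < b"
    show "u a * (1 - exp (- (cum b - cum a))) * exp (- window b) \<le> u a - u b"
      using survival_decrease_ge[OF ab l] half_open[of a b] opened[of b "b + l"] ab l
      by (simp add: u_def window_def)
  next
    fix a b :: real assume ab: "l \<le> a" "a < b" "b < a + l"
    show "u a - u b \<le> u (a - l) * (1 - exp (- (cum b - cum a))) * exp (- (cum (a + l) - cum b))"
      using survival_decrease_le[of a l b] half_open[of a b] opened[of b "a + l"] ab l
      by (simp add: u_def)
  qed (use assms in auto)
  moreover have "((\<lambda>t. integral {c..t} local_hazard / cum_hazard t) \<longlongrightarrow> 1) at_top"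
  proof (rule cum_local_hazard_ratio[OF _ div \<open>0 \<le> c\<close>])
    have "((\<lambda>t. enn2real (cumulative_rate \<mu> t (t + l)) - l * \<mu> t) \<longlongrightarrow> 0) at_top"
      using smalloD_tendsto[OF assms(6)] by simp
    moreover have "\<forall>\<^sub>F t in at_top. enn2real (cumulative_rate \<mu> t (t + l)) - l * \<mu> t = window t - l * \<mu> t"
      using eventually_ge_at_top[of 0]
    proof eventually_elim
      case (elim t)
      then show ?case
        using window_nonneg[of t] cumulative_rate_eq[of t "t + l"] l by (simp add: window_def)
    qed
    ultimately show "((\<lambda>t. window t - l * \<mu> t) \<longlongrightarrow> 0) at_top"
      by (rule Lim_transform_eventually)
  qed
  ultimately have "((\<lambda>t. (- ln (u t) / cum_hazard t) / (integral {c..t} local_hazard / cum_hazard t))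
      \<longlongrightarrow> 1 / 1) at_top"
    by (rule tendsto_divide) simp
  moreover have "\<forall>\<^sub>F t in at_top.
      (- ln (u t) / cum_hazard t) / (integral {c..t} local_hazard / cum_hazard t) =
      ln (measure P {\<omega> \<in> space P. ereal t < gap_start l (N \<omega>)}) /
      ln (exp (- interval_lebesgue_integral lebesgue c t (\<lambda>s. exp (- l * \<mu> s) * \<mu> s)))"
    using eventually_ge_at_top[of c] filterlim_at_top_dense[THEN iffD1, OF div, rule_format, of 0]
  proof eventually_elim
    case (elim t)
    then show ?case
      using interval_integral_local_hazard[OF \<open>0 \<le> c\<close>, of t] by (simp add: tail)
  qed
  ultimately show ?thesis
    unfolding log_asymp_def using Lim_transform_eventually by fastforce
qed

end
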